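(* Let $f : X \to Y$ be a simplicial map and $\tilde f : X^f \to Y$ its Reeb space. Then there is a canonical isomorphism $H_0(X^f) \cong H_0(X)$ and a canonical inclusion $H_1(X^f) \hookrightarrow H_1(X)$.
   Context: Fix a field $K$; homology is simplicial homology with coefficients in $K$. $X$ and $Y$ are simplicial complexes, and simplices are open. For a simplex $\tau\in Y$, $f^{-1}(\tau)$ consists of the simplices $\sigma\in X$ with $f(\sigma)=\tau$. Declare two simplices $\sigma,\sigma'\in X$ equivalent, $\sigma\sim\sigma'$, if $f(\sigma)=f(\sigma')=\tau$ and both belong to the same (connected) component of $f^{-1}(\tau)$. The quotient $X^f := X/\!\sim$ is a simplicial complex and $f$ induces a simplicial map $\tilde f : X^f\to Y$, where $\tilde f(\tilde\sigma):=f(\sigma)$ for any $\sigma$ in the equivalence class represented by $\tilde\sigma$; the map $f$ is the composite of the quotient map $X\to X^f$ with $\tilde f$. The map $\tilde f$ is called the Reeb space of $f$.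
   Formalization: No inclusion H_1(X^f) → H_1(X) natural in f exists (torus projecting to a circle, non-homologous sections); "canonical inclusion" is replaced by the existence of a linear injection that is a section of the canonical map H_1(X) → H_1(X^f). *)

theory Defs
  imports Complex_Main "HOL-Library.Poly_Mapping" "Jordan_Normal_Form.VS_Connect"
begin

section \<open>Simplicial complexes and simplicial maps\<close>

definition simplicial_complex :: "'a set set \<Rightarrow> bool" where
  "simplicial_complex X \<longleftrightarrow>
     (\<forall>\<sigma>\<in>X. finite \<sigma> \<and> \<sigma> \<noteq> {}) \<and> (\<forall>\<sigma>\<in>X. \<forall>\<rho>. \<rho> \<subseteq> \<sigma> \<longrightarrow> \<rho> \<noteq> {} \<longrightarrow> \<rho> \<in> X)"

definition simplicial_map :: "('a \<Rightarrow> 'b) \<Rightarrow> 'a set set \<Rightarrow> 'b set set \<Rightarrow> bool" where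
  "simplicial_map f X Y \<longleftrightarrow> (\<forall>\<sigma>\<in>X. f ` \<sigma> \<in> Y)"

text \<open>
  The simplices of the Reeb space are equivalence classes of simplices, and two different ones may
  have the same vertices: if \<open>f\<close> folds a 4-cycle \<open>a\<^sub>1, a\<^sub>2, b\<^sub>2, b\<^sub>1\<close> onto an edge \<open>{a, b}\<close>,
  then the Reeb space has two vertices joined by two edges.  So the Reeb space is a simplicial
  complex only in the generalised sense (simplices are not determined by their vertices; also known
  as a simplicial poset).  In the record below, \<open>face s W\<close> is the face of \<open>s\<close> spanned
  by the nonempty set \<open>W \<subseteq> verts s\<close>.
\<close>

record ('s, 'v) scomplex =
  simplices :: "'s set"
  verts :: "'s \<Rightarrow> 'v set"
  face :: "'s \<Rightarrow> 'v set \<Rightarrow> 's"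

definition generalized_complex :: "('s, 'v) scomplex \<Rightarrow> bool" where
  "generalized_complex P \<longleftrightarrow>
     (\<forall>s\<in>simplices P. finite (verts P s) \<and> verts P s \<noteq> {} \<and> face P s (verts P s) = s \<and>
        (\<forall>W. W \<subseteq> verts P s \<longrightarrow> W \<noteq> {} \<longrightarrow>
           face P s W \<in> simplices P \<and> verts P (face P s W) = W \<and>
           (\<forall>U. U \<subseteq> W \<longrightarrow> U \<noteq> {} \<longrightarrow> face P (face P s W) U = face P s U))) \<and>
     (\<forall>s\<in>simplices P. \<forall>t\<in>simplices P. \<forall>v. verts P s = {v} \<longrightarrow> verts P t = {v} \<longrightarrow> s = t)"

definition generalized_map ::
  "('s, 'v) scomplex \<Rightarrow> ('t, 'w) scomplex \<Rightarrow> ('s \<Rightarrow> 't) \<Rightarrow> ('v \<Rightarrow> 'w) \<Rightarrow> bool" where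
  "generalized_map P Q g h \<longleftrightarrow>
     (\<forall>s\<in>simplices P. g s \<in> simplices Q \<and> verts Q (g s) = h ` verts P s \<and>
        (\<forall>W. W \<subseteq> verts P s \<longrightarrow> W \<noteq> {} \<longrightarrow> g (face P s W) = face Q (g s) (h ` W)))"

definition ordinary :: "'a set set \<Rightarrow> ('a set, 'a) scomplex" where
  "ordinary X = \<lparr>simplices = X, verts = (\<lambda>\<sigma>. \<sigma>), face = (\<lambda>\<sigma> W. W)\<rparr>"

lemma generalized_complex_ordinary:
  assumes "simplicial_complex X"
  shows "generalized_complex (ordinary X)"
proof -
  have "\<rho> \<in> X" if "\<sigma> \<in> X" "\<rho> \<subseteq> \<sigma>" "\<rho> \<noteq> {}" for \<rho> \<sigma>
    using assms that unfolding simplicial_complex_def by blast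
  moreover have "finite \<sigma> \<and> \<sigma> \<noteq> {}" if "\<sigma> \<in> X" for \<sigma>
    using assms that unfolding simplicial_complex_def by blast
  ultimately show ?thesis
    unfolding generalized_complex_def ordinary_def scomplex.simps by metis
qed


section \<open>Simplicial homology with coefficients in a field\<close>

definition chain_scale :: "'k::field \<Rightarrow> ('b \<Rightarrow>\<^sub>0 'k) \<Rightarrow> ('b \<Rightarrow>\<^sub>0 'k)" where
  "chain_scale a c = Poly_Mapping.map ((*) a) c"

lemma lookup_chain_scale [simp]:
  "Poly_Mapping.lookup (chain_scale a c) x = a * Poly_Mapping.lookup c x"
  by (simp add: chain_scale_def Poly_Mapping.map.rep_eq when_def)

global_interpretation chains: vector_space "chain_scale :: 'k::field \<Rightarrow> ('b \<Rightarrow>\<^sub>0 'k) \<Rightarrow> ('b \<Rightarrow>\<^sub>0 'k)"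
  by unfold_locales
    (auto intro!: poly_mapping_eqI simp: lookup_add algebra_simps)

definition chain_extend :: "('b \<Rightarrow> ('c \<Rightarrow>\<^sub>0 'k)) \<Rightarrow> ('b \<Rightarrow>\<^sub>0 'k::field) \<Rightarrow> ('c \<Rightarrow>\<^sub>0 'k)" where
  "chain_extend \<phi> c = (\<Sum>x\<in>Poly_Mapping.keys c. chain_scale (Poly_Mapping.lookup c x) (\<phi> x))"

text \<open>
  The oriented chain complex is \<open>C\<^sub>n = F\<^sub>n / D\<^sub>n\<close>: \<open>F\<^sub>n\<close> is free on the pairs of a
  simplex \<open>s\<close> and a listing \<open>[v\<^sub>0, \<dots>, v\<^sub>n]\<close> of its vertices, possibly with
  repetitions, and \<open>D\<^sub>n\<close> imposes the usual conventions that a listing with a repeated vertex is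
  zero and that exchanging two vertices changes the sign.  The simplex has to be recorded because the
  vertices need not determine it.
\<close>

definition ordered_simplices :: "('s, 'v) scomplex \<Rightarrow> nat \<Rightarrow> ('s \<times> 'v list) set" where
  "ordered_simplices P n =
     {(s, vs). s \<in> simplices P \<and> length vs = Suc n \<and> set vs = verts P s}"

definition ordered_chains :: "('s, 'v) scomplex \<Rightarrow> nat \<Rightarrow> ('s \<times> 'v list \<Rightarrow>\<^sub>0 'k::field) set" where
  "ordered_chains P n = {c. Poly_Mapping.keys c \<subseteq> ordered_simplices P n}"

definition orientation_relations ::
  "('s, 'v) scomplex \<Rightarrow> nat \<Rightarrow> ('s \<times> 'v list \<Rightarrow>\<^sub>0 'k::field) set" where
  "orientation_relations P n = chains.span
     ({Poly_Mapping.single (s, vs) 1 | s vs. (s, vs) \<in> ordered_simplices P n \<and> \<not> distinct vs} \<union>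
      {Poly_Mapping.single (s, vs) 1 + Poly_Mapping.single (s, vs[i := vs ! j, j := vs ! i]) 1
         | s vs i j. (s, vs) \<in> ordered_simplices P n \<and> i < j \<and> j < length vs})"

definition remove_nth :: "nat \<Rightarrow> 'v list \<Rightarrow> 'v list" where
  "remove_nth i vs = take i vs @ drop (Suc i) vs"

text \<open>0-chains have zero boundary (unreduced homology).\<close>

definition boundary_simplex ::
  "('s, 'v) scomplex \<Rightarrow> 's \<times> 'v list \<Rightarrow> ('s \<times> 'v list \<Rightarrow>\<^sub>0 'k::field)" where
  "boundary_simplex P = (\<lambda>(s, vs). if length vs \<le> 1 then 0 else
     (\<Sum>i<length vs. Poly_Mapping.single
        (face P s (set (remove_nth i vs)), remove_nth i vs) ((- 1) ^ i)))"

definition boundary ::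
  "('s, 'v) scomplex \<Rightarrow> ('s \<times> 'v list \<Rightarrow>\<^sub>0 'k::field) \<Rightarrow> ('s \<times> 'v list \<Rightarrow>\<^sub>0 'k)" where
  "boundary P = chain_extend (boundary_simplex P)"

text \<open>
  The preimages in \<open>F\<^sub>n\<close> of the cycles and of the boundaries of \<open>C\<^sub>n\<close>, so that their
  quotient is \<open>H\<^sub>n\<close>.  For \<open>n = 0\<close> the truncated index \<open>n - 1\<close> is harmless since
  the boundary vanishes there.
\<close>

definition cycles :: "('s, 'v) scomplex \<Rightarrow> nat \<Rightarrow> ('s \<times> 'v list \<Rightarrow>\<^sub>0 'k::field) set" where
  "cycles P n = {c \<in> ordered_chains P n. boundary P c \<in> orientation_relations P (n - 1)}"

definition boundaries :: "('s, 'v) scomplex \<Rightarrow> nat \<Rightarrow> ('s \<times> 'v list \<Rightarrow>\<^sub>0 'k::field) set" where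
  "boundaries P n =
     {boundary P c + d | c d. c \<in> ordered_chains P (Suc n) \<and> d \<in> orientation_relations P n}"

definition homology_class ::
  "('s, 'v) scomplex \<Rightarrow> nat \<Rightarrow> ('s \<times> 'v list \<Rightarrow>\<^sub>0 'k::field) \<Rightarrow> ('s \<times> 'v list \<Rightarrow>\<^sub>0 'k) set" where
  "homology_class P n z = {z'. z' - z \<in> boundaries P n}"

text \<open>
  \<open>mult\<close> and \<open>one\<close> only occur because the module records of HOL-Algebra extend ring
  records; they are not part of the vector space structure.
\<close>

definition homology ::
  "'k::field itself \<Rightarrow> ('s, 'v) scomplex \<Rightarrow> nat \<Rightarrow> ('k, ('s \<times> 'v list \<Rightarrow>\<^sub>0 'k) set) module" where
  "homology K P n =
     \<lparr>carrier = homology_class P n ` cycles P n,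
      mult = undefined, one = undefined,
      zero = homology_class P n 0,
      add = (\<lambda>A B. \<Union>a\<in>A. \<Union>b\<in>B. homology_class P n (a + b)),
      smult = (\<lambda>r A. \<Union>a\<in>A. homology_class P n (chain_scale r a))\<rparr>"

definition induced_chain_map ::
  "('s \<Rightarrow> 't) \<Rightarrow> ('v \<Rightarrow> 'w) \<Rightarrow> ('s \<times> 'v list \<Rightarrow>\<^sub>0 'k::field) \<Rightarrow> ('t \<times> 'w list \<Rightarrow>\<^sub>0 'k)" where
  "induced_chain_map g h =
     chain_extend (\<lambda>(s, vs). Poly_Mapping.single (g s, map h vs) 1)"

definition homology_map ::
  "'k::field itself \<Rightarrow> ('t, 'w) scomplex \<Rightarrow> ('s \<Rightarrow> 't) \<Rightarrow> ('v \<Rightarrow> 'w) \<Rightarrow> nat \<Rightarrow>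
     ('s \<times> 'v list \<Rightarrow>\<^sub>0 'k) set \<Rightarrow> ('t \<times> 'w list \<Rightarrow>\<^sub>0 'k) set" where
  "homology_map K Q g h n A = (\<Union>a\<in>A. homology_class Q n (induced_chain_map g h a))"


section \<open>The Reeb space of a simplicial map\<close>

definition fibre :: "'a set set \<Rightarrow> ('a \<Rightarrow> 'b) \<Rightarrow> 'b set \<Rightarrow> 'a set set" where
  "fibre X f \<tau> = {\<sigma> \<in> X. f ` \<sigma> = \<tau>}"

text \<open>
  A set \<open>A\<close> of open simplices is in general not a subcomplex.  Two open simplices of
  \<open>A\<close> have a connected union iff one is a face of the other, and the components of (the union
  of) \<open>A\<close> are generated by this incidence relation.
\<close>

definition same_component :: "'a set set \<Rightarrow> ('a set \<times> 'a set) set" where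
  "same_component A =
     {(\<sigma>, \<sigma>') \<in> A \<times> A. (\<sigma>, \<sigma>') \<in> {(\<rho>, \<rho>') \<in> A \<times> A. \<rho> \<subseteq> \<rho>' \<or> \<rho>' \<subseteq> \<rho>}\<^sup>*}"

definition reeb_equiv :: "'a set set \<Rightarrow> ('a \<Rightarrow> 'b) \<Rightarrow> ('a set \<times> 'a set) set" where
  "reeb_equiv X f =
     {(\<sigma>, \<sigma>') \<in> X \<times> X. f ` \<sigma> = f ` \<sigma>' \<and> (\<sigma>, \<sigma>') \<in> same_component (fibre X f (f ` \<sigma>))}"

definition reeb_class :: "'a set set \<Rightarrow> ('a \<Rightarrow> 'b) \<Rightarrow> 'a set \<Rightarrow> 'a set set" where
  "reeb_class X f \<sigma> = reeb_equiv X f `` {\<sigma>}"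

definition reeb_vertex :: "'a set set \<Rightarrow> ('a \<Rightarrow> 'b) \<Rightarrow> 'a \<Rightarrow> 'a set set" where
  "reeb_vertex X f v = reeb_class X f {v}"

text \<open>
  The vertices and faces of a class are those of any representative; as is customary for functions
  on quotients, the union over all representatives is a union of equal sets.
\<close>

definition reeb_space :: "'a set set \<Rightarrow> ('a \<Rightarrow> 'b) \<Rightarrow> ('a set set, 'a set set) scomplex" where
  "reeb_space X f =
     \<lparr>simplices = X // reeb_equiv X f,
      verts = (\<lambda>C. \<Union>\<sigma>\<in>C. reeb_vertex X f ` \<sigma>),
      face = (\<lambda>C W. \<Union>\<sigma>\<in>C. reeb_class X f {v \<in> \<sigma>. reeb_vertex X f v \<in> W})\<rparr>"

definition reeb_map :: "('a \<Rightarrow> 'b) \<Rightarrow> 'a set set \<Rightarrow> 'b set" where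
  "reeb_map f C = (\<Union>\<sigma>\<in>C. f ` \<sigma>)"

definition reeb_vertex_map :: "('a \<Rightarrow> 'b) \<Rightarrow> 'a set set \<Rightarrow> 'b" where
  "reeb_vertex_map f C = the_elem (reeb_map f C)"

text \<open>
  The map in homology induced by the quotient map from \<open>X\<close> to its Reeb space is what makes the
  comparison canonical.  In degree 1 an inclusion of \<open>H\<^sub>1\<close> of the Reeb space is canonical in
  the sense of being a section of this map.  An inclusion natural in \<open>f\<close> does not exist: for the
  projection of a torus onto a circle the Reeb space is the circle, and sections of the projection
  with different homology classes would have to induce the same inclusion.
\<close>

definition reeb_homology_map ::
  "'k::field itself \<Rightarrow> 'a set set \<Rightarrow> ('a \<Rightarrow> 'b) \<Rightarrow> nat \<Rightarrow>
     ('a set \<times> 'a list \<Rightarrow>\<^sub>0 'k) set \<Rightarrow> ('a set set \<times> 'a set set list \<Rightarrow>\<^sub>0 'k) set" where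
  "reeb_homology_map K X f = homology_map K (reeb_space X f) (reeb_class X f) (reeb_vertex X f)"


section \<open>The constructions are well-defined\<close>

lemma same_component_equiv: "equiv A (same_component A)"
proof (rule equivI)
  let ?r = "{(\<rho>, \<rho>') \<in> A \<times> A. \<rho> \<subseteq> \<rho>' \<or> \<rho>' \<subseteq> \<rho>}"
  show "same_component A \<subseteq> A \<times> A" "refl_on A (same_component A)"
    by (auto simp: same_component_def refl_on_def)
  have "sym ?r" by (auto simp: sym_def)
  then have "sym (?r\<^sup>*)" by (rule sym_rtrancl)
  then show "sym (same_component A)"
    unfolding same_component_def sym_def by blast
  show "trans (same_component A)"
    unfolding same_component_def trans_def by (auto intro: rtrancl_trans)
qed

lemma reeb_equiv_equiv: "equiv X (reeb_equiv X f)"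
proof (rule equivI)
  have eq: "equiv (fibre X f \<tau>) (same_component (fibre X f \<tau>))" for \<tau>
    by (rule same_component_equiv)
  show "reeb_equiv X f \<subseteq> X \<times> X" by (auto simp: reeb_equiv_def)
  show "refl_on X (reeb_equiv X f)"
    using eq by (auto simp: reeb_equiv_def refl_on_def equiv_def fibre_def)
  show "sym (reeb_equiv X f)"
    using eq unfolding sym_def reeb_equiv_def equiv_def by fastforce
  show "trans (reeb_equiv X f)"
    using eq unfolding trans_def reeb_equiv_def equiv_def
    by (smt (verit, ccfv_SIG) case_prodD case_prodI2 mem_Collect_eq mem_Sigma_iff old.prod.case)
qed

lemma reeb_class_eq_iff:
  "\<sigma> \<in> X \<Longrightarrow> \<sigma>' \<in> X \<Longrightarrow>
     reeb_class X f \<sigma> = reeb_class X f \<sigma>' \<longleftrightarrow> (\<sigma>, \<sigma>') \<in> reeb_equiv X f"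
  unfolding reeb_class_def using reeb_equiv_equiv by (metis eq_equiv_class_iff)

lemma reeb_class_self: "\<sigma> \<in> X \<Longrightarrow> \<sigma> \<in> reeb_class X f \<sigma>"
  unfolding reeb_class_def using reeb_equiv_equiv by (metis equiv_class_self)

lemma reeb_equiv_sym: "(\<sigma>, \<sigma>') \<in> reeb_equiv X f \<Longrightarrow> (\<sigma>', \<sigma>) \<in> reeb_equiv X f"
  using reeb_equiv_equiv[of X f] unfolding equiv_def sym_def by blast

lemma reeb_equiv_trans:
  "(\<sigma>, \<sigma>') \<in> reeb_equiv X f \<Longrightarrow> (\<sigma>', \<sigma>'') \<in> reeb_equiv X f \<Longrightarrow> (\<sigma>, \<sigma>'') \<in> reeb_equiv X f"
  using reeb_equiv_equiv[of X f] unfolding equiv_def trans_def by blast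

lemma reeb_class_eqI: "(\<sigma>, \<sigma>') \<in> reeb_equiv X f \<Longrightarrow> reeb_class X f \<sigma> = reeb_class X f \<sigma>'"
  unfolding reeb_class_def using reeb_equiv_equiv by (metis equiv_class_eq)

lemma reeb_equivD: "(\<sigma>, \<sigma>') \<in> reeb_equiv X f \<Longrightarrow> \<sigma> \<in> X \<and> \<sigma>' \<in> X \<and> f ` \<sigma> = f ` \<sigma>'"
  by (auto simp: reeb_equiv_def)

lemma reeb_equiv_face:
  "\<rho> \<in> X \<Longrightarrow> \<sigma> \<in> X \<Longrightarrow> \<rho> \<subseteq> \<sigma> \<Longrightarrow> f ` \<rho> = f ` \<sigma> \<Longrightarrow> (\<rho>, \<sigma>) \<in> reeb_equiv X f"
  by (auto simp: reeb_equiv_def same_component_def fibre_def intro!: r_into_rtrancl)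

lemma reeb_equiv_induct [consumes 1, case_names refl step]:
  assumes "(\<sigma>, \<sigma>') \<in> reeb_equiv X f"
    and "P \<sigma>"
    and "\<And>\<rho> \<rho>'. \<rho> \<in> X \<Longrightarrow> \<rho>' \<in> X \<Longrightarrow> f ` \<rho> = f ` \<sigma> \<Longrightarrow> f ` \<rho>' = f ` \<sigma> \<Longrightarrow>
           \<rho> \<subseteq> \<rho>' \<or> \<rho>' \<subseteq> \<rho> \<Longrightarrow> P \<rho> \<Longrightarrow> P \<rho>'"
  shows "P \<sigma>'"
proof -
  let ?A = "fibre X f (f ` \<sigma>)"
  have "(\<sigma>, \<sigma>') \<in> {(\<rho>, \<rho>') \<in> ?A \<times> ?A. \<rho> \<subseteq> \<rho>' \<or> \<rho>' \<subseteq> \<rho>}\<^sup>*"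
    using assms(1) by (auto simp: reeb_equiv_def same_component_def)
  then show ?thesis
    by (induction rule: rtrancl_induct) (use assms(2,3) in \<open>auto simp: fibre_def\<close>)
qed

context
  fixes X :: "'a set set" and f :: "'a \<Rightarrow> 'b"
  assumes X: "simplicial_complex X"
begin

lemma subface: "\<sigma> \<in> X \<Longrightarrow> \<rho> \<subseteq> \<sigma> \<Longrightarrow> \<rho> \<noteq> {} \<Longrightarrow> \<rho> \<in> X"
  using X unfolding simplicial_complex_def by blast

lemma reeb_vertex_eq_iff:
  assumes "\<sigma> \<in> X" "v \<in> \<sigma>" "w \<in> \<sigma>"
  shows "reeb_vertex X f v = reeb_vertex X f w \<longleftrightarrow> f v = f w"
proof
  have v: "{v} \<in> X" and w: "{w} \<in> X" and vw: "{v, w} \<in> X"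
    using assms subface by auto
  {
    assume "reeb_vertex X f v = reeb_vertex X f w"
    then show "f v = f w"
      using reeb_class_eq_iff[OF v w] reeb_equivD unfolding reeb_vertex_def by fastforce
  }
  assume "f v = f w"
  then have "({v}, {v, w}) \<in> reeb_equiv X f" "({w}, {v, w}) \<in> reeb_equiv X f"
    using v w vw by (auto intro!: reeb_equiv_face)
  then show "reeb_vertex X f v = reeb_vertex X f w"
    unfolding reeb_vertex_def by (metis reeb_class_eqI)
qed

lemma restrict_equiv:
  assumes "(\<sigma>, \<sigma>') \<in> reeb_equiv X f" "T \<inter> f ` \<sigma> \<noteq> {}"
  shows "({v \<in> \<sigma>. f v \<in> T}, {v \<in> \<sigma>'. f v \<in> T}) \<in> reeb_equiv X f"
proof -
  have \<sigma>: "\<sigma> \<in> X" using assms reeb_equivD by blast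
  have ne: "{v \<in> \<rho>. f v \<in> T} \<in> X" if "\<rho> \<in> X" "f ` \<rho> = f ` \<sigma>" for \<rho>
  proof (rule subface[OF that(1)])
    have "T \<inter> f ` \<rho> \<noteq> {}" using assms(2) that(2) by simp
    then show "{v \<in> \<rho>. f v \<in> T} \<noteq> {}" by blast
  qed auto
  have img: "f ` {v \<in> \<rho>. f v \<in> T} = T \<inter> f ` \<sigma>" if "f ` \<rho> = f ` \<sigma>" for \<rho>
    unfolding that[symmetric] by blast
  show ?thesis using assms(1)
  proof (induction rule: reeb_equiv_induct)
    case refl
    show ?case using reeb_equiv_equiv ne[OF \<sigma>] by (auto simp: equiv_def refl_on_def)
  next
    case (step \<rho> \<rho>')
    let ?r = "{v \<in> \<rho>. f v \<in> T}" and ?r' = "{v \<in> \<rho>'. f v \<in> T}"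
    have "?r \<in> X" "?r' \<in> X" "f ` ?r = f ` ?r'"
      using step ne img by auto
    moreover have "?r \<subseteq> ?r' \<or> ?r' \<subseteq> ?r" using step by auto
    ultimately have "(?r, ?r') \<in> reeb_equiv X f"
      using reeb_equiv_face[of ?r X ?r' f] reeb_equiv_face[of ?r' X ?r f, THEN reeb_equiv_sym]
      by argo
    then show ?case
      using step.IH reeb_equiv_trans by blast
  qed
qed

lemma verts_reeb_class:
  assumes "\<sigma> \<in> X"
  shows "verts (reeb_space X f) (reeb_class X f \<sigma>) = reeb_vertex X f ` \<sigma>"
proof -
  have sub: "reeb_vertex X f ` \<rho> \<subseteq> reeb_vertex X f ` \<rho>'" if "(\<rho>, \<rho>') \<in> reeb_equiv X f" for \<rho> \<rho>'
  proof
    fix C assume "C \<in> reeb_vertex X f ` \<rho>"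
    then obtain v where v: "v \<in> \<rho>" and C: "C = reeb_vertex X f v" by auto
    let ?r = "{w \<in> \<rho>. f w \<in> {f v}}" and ?r' = "{w \<in> \<rho>'. f w \<in> {f v}}"
    have \<rho>: "\<rho> \<in> X" "\<rho>' \<in> X" "f ` \<rho> = f ` \<rho>'" using that reeb_equivD by blast+
    have eq: "(?r, ?r') \<in> reeb_equiv X f" using v by (intro restrict_equiv that) auto
    have "f v \<in> f ` \<rho>'" using v unfolding \<rho>(3)[symmetric] by (rule imageI)
    then obtain w where w: "w \<in> \<rho>'" "f w = f v" by force
    have "({v}, ?r) \<in> reeb_equiv X f"
      using v reeb_equivD[OF eq] by (intro reeb_equiv_face subface[OF \<rho>(1)]) auto
    moreover have "({w}, ?r') \<in> reeb_equiv X f"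
      using w reeb_equivD[OF eq] by (intro reeb_equiv_face subface[OF \<rho>(2)]) auto
    ultimately have "({v}, {w}) \<in> reeb_equiv X f"
      using eq reeb_equiv_sym reeb_equiv_trans by blast
    then have "reeb_vertex X f v = reeb_vertex X f w"
      unfolding reeb_vertex_def by (rule reeb_class_eqI)
    then show "C \<in> reeb_vertex X f ` \<rho>'" using C w by auto
  qed
  have "reeb_vertex X f ` \<rho> = reeb_vertex X f ` \<sigma>" if "\<rho> \<in> reeb_class X f \<sigma>" for \<rho>
  proof -
    have "(\<sigma>, \<rho>) \<in> reeb_equiv X f" using that by (auto simp: reeb_class_def)
    moreover from this have "(\<rho>, \<sigma>) \<in> reeb_equiv X f"
      by (rule reeb_equiv_sym)
    ultimately show ?thesis using sub by blast
  qed
  then show ?thesis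
    using reeb_class_self[OF assms] by (auto simp: reeb_space_def)
qed

lemma face_reeb_class:
  assumes "\<rho> \<in> X" "\<sigma> \<in> X" "\<rho> \<subseteq> \<sigma>"
  shows "face (reeb_space X f) (reeb_class X f \<sigma>) (reeb_vertex X f ` \<rho>) = reeb_class X f \<rho>"
proof -
  have "reeb_class X f {v \<in> \<sigma>'. reeb_vertex X f v \<in> reeb_vertex X f ` \<rho>} = reeb_class X f \<rho>"
    if "\<sigma>' \<in> reeb_class X f \<sigma>" for \<sigma>'
  proof -
    have eq: "(\<sigma>, \<sigma>') \<in> reeb_equiv X f" using that by (auto simp: reeb_class_def)
    have \<sigma>': "\<sigma>' \<in> X" "f ` \<sigma> = f ` \<sigma>'" using eq reeb_equivD by blast+
    have verts: "reeb_vertex X f ` \<sigma>' = reeb_vertex X f ` \<sigma>"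
      using verts_reeb_class[OF assms(2)] verts_reeb_class[OF \<sigma>'(1)]
        reeb_class_eq_iff[OF assms(2) \<sigma>'(1)] eq by metis
    have iff: "reeb_vertex X f v \<in> reeb_vertex X f ` \<rho> \<longleftrightarrow> f v \<in> f ` \<rho>" if v: "v \<in> \<sigma>'" for v
    proof -
      obtain w where w: "w \<in> \<sigma>" "reeb_vertex X f v = reeb_vertex X f w"
        using verts v by (metis imageE imageI)
      have "f v = f w"
      proof -
        have "{v} \<in> X" "{w} \<in> X" using v w \<sigma>' assms subface by auto
        then show ?thesis
          using w(2) reeb_class_eq_iff[of "{v}" X "{w}" f] reeb_equivD[of "{v}" "{w}" X f]
          unfolding reeb_vertex_def by simp
      qed
      moreover have "reeb_vertex X f w \<in> reeb_vertex X f ` \<rho> \<longleftrightarrow> f w \<in> f ` \<rho>"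
        using reeb_vertex_eq_iff[OF assms(2) w(1)] assms(3) by (auto simp: image_iff)
      ultimately show ?thesis using w(2) by simp
    qed
    then have restr: "{v \<in> \<sigma>'. reeb_vertex X f v \<in> reeb_vertex X f ` \<rho>} = {v \<in> \<sigma>'. f v \<in> f ` \<rho>}"
      by auto
    have ne: "\<rho> \<noteq> {}" using assms(1) X by (auto simp: simplicial_complex_def)
    have "({v \<in> \<sigma>. f v \<in> f ` \<rho>}, {v \<in> \<sigma>'. f v \<in> f ` \<rho>}) \<in> reeb_equiv X f"
      using eq ne assms(3) by (intro restrict_equiv) auto
    moreover have "(\<rho>, {v \<in> \<sigma>. f v \<in> f ` \<rho>}) \<in> reeb_equiv X f"
      using assms ne by (intro reeb_equiv_face) (auto intro!: subface[OF assms(2)])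
    ultimately have "(\<rho>, {v \<in> \<sigma>'. f v \<in> f ` \<rho>}) \<in> reeb_equiv X f"
      using reeb_equiv_trans by blast
    then show ?thesis
      using restr by (simp add: reeb_class_eqI)
  qed
  then show ?thesis
    using reeb_class_self[OF assms(2)] by (auto simp: reeb_space_def)
qed

lemma simplices_reeb_space: "simplices (reeb_space X f) = reeb_class X f ` X"
  by (auto simp: reeb_space_def reeb_class_def quotient_def)

lemma lift_face:
  assumes "\<sigma> \<in> X" "W \<subseteq> reeb_vertex X f ` \<sigma>" "W \<noteq> {}"
  obtains \<rho> where "\<rho> \<in> X" "\<rho> \<subseteq> \<sigma>" "W = reeb_vertex X f ` \<rho>"
proof
  show "{v \<in> \<sigma>. reeb_vertex X f v \<in> W} \<in> X" using assms by (intro subface[OF assms(1)]) auto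
  show "{v \<in> \<sigma>. reeb_vertex X f v \<in> W} \<subseteq> \<sigma>" by blast
  show "W = reeb_vertex X f ` {v \<in> \<sigma>. reeb_vertex X f v \<in> W}" using assms(2) by blast
qed

lemma generalized_complex_reeb_space: "generalized_complex (reeb_space X f)"
proof -
  let ?R = "reeb_space X f" and ?c = "reeb_class X f" and ?v = "reeb_vertex X f"
  have 1: "finite (verts ?R (?c \<sigma>)) \<and> verts ?R (?c \<sigma>) \<noteq> {} \<and> face ?R (?c \<sigma>) (verts ?R (?c \<sigma>)) = ?c \<sigma>"
    if \<sigma>: "\<sigma> \<in> X" for \<sigma>
    using X \<sigma> by (simp add: verts_reeb_class face_reeb_class simplicial_complex_def)
  have 2: "face ?R (?c \<sigma>) W \<in> ?c ` X \<and> verts ?R (face ?R (?c \<sigma>) W) = W \<and>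
      (\<forall>U. U \<subseteq> W \<longrightarrow> U \<noteq> {} \<longrightarrow> face ?R (face ?R (?c \<sigma>) W) U = face ?R (?c \<sigma>) U)"
    if \<sigma>: "\<sigma> \<in> X" and W: "W \<subseteq> verts ?R (?c \<sigma>)" "W \<noteq> {}" for \<sigma> W
  proof (intro conjI allI impI)
    obtain \<rho> where \<rho>: "\<rho> \<in> X" "\<rho> \<subseteq> \<sigma>" "W = ?v ` \<rho>"
      using lift_face[OF \<sigma>] W unfolding verts_reeb_class[OF \<sigma>] by metis
    show "face ?R (?c \<sigma>) W \<in> ?c ` X" "verts ?R (face ?R (?c \<sigma>) W) = W"
      using \<rho> \<sigma> by (simp_all add: face_reeb_class verts_reeb_class)
    fix U assume U: "U \<subseteq> W" "U \<noteq> {}"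
    then obtain \<pi> where "\<pi> \<in> X" "\<pi> \<subseteq> \<rho>" "U = ?v ` \<pi>"
      using lift_face[OF \<rho>(1)] unfolding \<rho>(3) by metis
    then show "face ?R (face ?R (?c \<sigma>) W) U = face ?R (?c \<sigma>) U"
      using \<rho> \<sigma> by (simp add: face_reeb_class)
  qed
  have 3: "?c \<rho> = D" if \<rho>: "\<rho> \<in> X" "verts ?R (?c \<rho>) = {D}" for \<rho> D
  proof -
    have D: "?v ` \<rho> = {D}" using \<rho> by (simp add: verts_reeb_class)
    then obtain v where v: "v \<in> \<rho>" by blast
    have "f w = f v" if "w \<in> \<rho>" for w
      using reeb_vertex_eq_iff[OF \<rho>(1) that v] D v that by blast
    then have "f ` {v} = f ` \<rho>" using v by blast
    then have "({v}, \<rho>) \<in> reeb_equiv X f"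
      using v by (intro reeb_equiv_face \<rho>(1) subface[OF \<rho>(1)]) simp_all
    then have "?v v = ?c \<rho>" unfolding reeb_vertex_def by (rule reeb_class_eqI)
    then show ?thesis using D v by blast
  qed
  show ?thesis
    unfolding generalized_complex_def simplices_reeb_space ball_simps
  proof (intro conjI ballI)
    fix \<sigma> assume "\<sigma> \<in> X"
    then show "finite (verts ?R (?c \<sigma>))" "verts ?R (?c \<sigma>) \<noteq> {}"
        "face ?R (?c \<sigma>) (verts ?R (?c \<sigma>)) = ?c \<sigma>"
      using 1 by simp_all
    show "\<forall>W. W \<subseteq> verts ?R (?c \<sigma>) \<longrightarrow> W \<noteq> {} \<longrightarrow> face ?R (?c \<sigma>) W \<in> ?c ` X \<and>
        verts ?R (face ?R (?c \<sigma>) W) = W \<and>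
        (\<forall>U. U \<subseteq> W \<longrightarrow> U \<noteq> {} \<longrightarrow> face ?R (face ?R (?c \<sigma>) W) U = face ?R (?c \<sigma>) U)"
      using 2[OF \<open>\<sigma> \<in> X\<close>] by simp
  next
    fix \<sigma> \<sigma>' assume "\<sigma> \<in> X" "\<sigma>' \<in> X"
    then show "\<forall>v. verts ?R (?c \<sigma>) = {v} \<longrightarrow> verts ?R (?c \<sigma>') = {v} \<longrightarrow> ?c \<sigma> = ?c \<sigma>'"
      using 3 by blast
  qed
qed

lemma generalized_map_reeb_class:
  "generalized_map (ordinary X) (reeb_space X f) (reeb_class X f) (reeb_vertex X f)"
  unfolding generalized_map_def ordinary_def scomplex.simps
proof (intro ballI conjI allI impI)
  fix \<sigma> assume \<sigma>: "\<sigma> \<in> X"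
  show "reeb_class X f \<sigma> \<in> simplices (reeb_space X f)"
    using \<sigma> by (simp add: simplices_reeb_space)
  show "verts (reeb_space X f) (reeb_class X f \<sigma>) = reeb_vertex X f ` \<sigma>"
    using \<sigma> by (rule verts_reeb_class)
  fix W assume "W \<subseteq> \<sigma>" "W \<noteq> {}"
  then show "reeb_class X f W =
      face (reeb_space X f) (reeb_class X f \<sigma>) (reeb_vertex X f ` W)"
    using \<sigma> subface by (simp add: face_reeb_class)
qed

lemma reeb_map_class:
  assumes "\<sigma> \<in> X"
  shows "reeb_map f (reeb_class X f \<sigma>) = f ` \<sigma>"
proof -
  have "f ` \<rho> = f ` \<sigma>" if "\<rho> \<in> reeb_class X f \<sigma>" for \<rho>
  proof -
    have "(\<sigma>, \<rho>) \<in> reeb_equiv X f" using that by (simp add: reeb_class_def)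
    from reeb_equivD[OF this] show ?thesis by simp
  qed
  then have "reeb_map f (reeb_class X f \<sigma>) = (\<Union>\<rho>\<in>reeb_class X f \<sigma>. f ` \<sigma>)"
    unfolding reeb_map_def by (rule SUP_cong[OF refl])
  then show ?thesis using reeb_class_self[OF assms] by auto
qed

lemma reeb_vertex_map_vertex: "{v} \<in> X \<Longrightarrow> reeb_vertex_map f (reeb_vertex X f v) = f v"
  by (simp add: reeb_vertex_map_def reeb_vertex_def reeb_map_class)

lemma generalized_map_reeb_map:
  assumes "simplicial_map f X Y"
  shows "generalized_map (reeb_space X f) (ordinary Y) (reeb_map f) (reeb_vertex_map f)"
proof -
  let ?R = "reeb_space X f" and ?c = "reeb_class X f" and ?v = "reeb_vertex X f"
  have img: "reeb_vertex_map f ` ?v ` \<rho> = f ` \<rho>" if \<rho>: "\<rho> \<in> X" for \<rho>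
  proof -
    have "reeb_vertex_map f (?v v) = f v" if "v \<in> \<rho>" for v
      using that by (intro reeb_vertex_map_vertex subface[OF \<rho>]) simp_all
    then show ?thesis by (simp add: image_image)
  qed
  have 1: "reeb_map f (face ?R (?c \<sigma>) W) = reeb_vertex_map f ` W"
    if \<sigma>: "\<sigma> \<in> X" and W: "W \<subseteq> verts ?R (?c \<sigma>)" "W \<noteq> {}" for \<sigma> W
  proof -
    obtain \<rho> where "\<rho> \<in> X" "\<rho> \<subseteq> \<sigma>" "W = ?v ` \<rho>"
      using lift_face[OF \<sigma>] W unfolding verts_reeb_class[OF \<sigma>] by metis
    then show ?thesis using \<sigma> img by (simp add: reeb_map_class face_reeb_class)
  qed
  have 2: "reeb_map f (?c \<sigma>) \<in> Y \<and> reeb_map f (?c \<sigma>) = reeb_vertex_map f ` verts ?R (?c \<sigma>)"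
    if "\<sigma> \<in> X" for \<sigma>
    using assms that img by (simp_all add: simplicial_map_def reeb_map_class verts_reeb_class)
  show ?thesis
    unfolding generalized_map_def simplices_reeb_space ball_simps ordinary_def scomplex.simps
  proof (intro ballI conjI allI impI)
    fix \<sigma> assume \<sigma>: "\<sigma> \<in> X"
    show "reeb_map f (?c \<sigma>) \<in> Y" "reeb_map f (?c \<sigma>) = reeb_vertex_map f ` verts ?R (?c \<sigma>)"
      using 2[OF \<sigma>] by blast+
    fix W assume "W \<subseteq> verts ?R (?c \<sigma>)" "W \<noteq> {}"
    then show "reeb_map f (face ?R (?c \<sigma>) W) = reeb_vertex_map f ` W"
      by (rule 1[OF \<sigma>])
  qed
qed

end

lemma chain_extend_superset:
  assumes "finite A" "Poly_Mapping.keys c \<subseteq> A"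
  shows "chain_extend \<phi> c = (\<Sum>x\<in>A. chain_scale (Poly_Mapping.lookup c x) (\<phi> x))"
  unfolding chain_extend_def
  by (rule sum.mono_neutral_left) (use assms in \<open>auto simp: in_keys_iff\<close>)

lemma chain_extend_add: "chain_extend \<phi> (c + d) = chain_extend \<phi> c + chain_extend \<phi> d"
proof -
  let ?A = "Poly_Mapping.keys c \<union> Poly_Mapping.keys d"
  have "Poly_Mapping.keys (c + d) \<subseteq> ?A" by (rule Poly_Mapping.keys_add)
  then show ?thesis
    by (simp add: chain_extend_superset[of ?A] lookup_add chains.scale_left_distrib sum.distrib)
qed

lemma keys_chain_scale: "Poly_Mapping.keys (chain_scale r c) \<subseteq> Poly_Mapping.keys c"
  by (auto simp: in_keys_iff)

lemma chain_extend_scale: "chain_extend \<phi> (chain_scale r c) = chain_scale r (chain_extend \<phi> c)"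
  unfolding chain_extend_superset[OF finite_keys keys_chain_scale]
  by (simp add: chain_extend_def chains.scale_sum_right)

lemma chain_extend_zero: "chain_extend \<phi> 0 = 0"
  by (simp add: chain_extend_def)

lemma subspace_ordered_chains:
  "chains.subspace (ordered_chains P n :: ('s \<times> 'v list \<Rightarrow>\<^sub>0 'k::field) set)"
  unfolding chains.subspace_def ordered_chains_def mem_Collect_eq
proof (intro conjI ballI allI)
  fix c d
  assume "c \<in> {c :: 's \<times> 'v list \<Rightarrow>\<^sub>0 'k. Poly_Mapping.keys c \<subseteq> ordered_simplices P n}"
    "d \<in> {c :: 's \<times> 'v list \<Rightarrow>\<^sub>0 'k. Poly_Mapping.keys c \<subseteq> ordered_simplices P n}"
  then show "Poly_Mapping.keys (c + d) \<subseteq> ordered_simplices P n"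
    using Poly_Mapping.keys_add[of c d] by (simp add: subset_trans)
next
  fix c r
  assume "c \<in> {c :: 's \<times> 'v list \<Rightarrow>\<^sub>0 'k. Poly_Mapping.keys c \<subseteq> ordered_simplices P n}"
  then show "Poly_Mapping.keys (chain_scale r c) \<subseteq> ordered_simplices P n"
    using keys_chain_scale[of r c] by simp
qed simp

lemma subspace_orientation_relations: "chains.subspace (orientation_relations P n)"
  unfolding orientation_relations_def by (rule chains.subspace_span)

lemma subspace_cycles: "chains.subspace (cycles P n)"
  using subspace_ordered_chains[of P n] subspace_orientation_relations[of P "n - 1"]
  unfolding chains.subspace_def cycles_def boundary_def mem_Collect_eq Ball_def
    chain_extend_add chain_extend_scale chain_extend_zero
  by blast

lemma subspace_boundaries:
  "chains.subspace (boundaries P n :: ('s \<times> 'v list \<Rightarrow>\<^sub>0 'k::field) set)"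
  unfolding chains.subspace_def
proof (intro conjI ballI allI)
  note F = subspace_ordered_chains[of P "Suc n"] and D = subspace_orientation_relations[of P n]
  have "(0 :: 's \<times> 'v list \<Rightarrow>\<^sub>0 'k) = boundary P 0 + 0"
    by (simp add: boundary_def chain_extend_zero)
  then show "(0 :: 's \<times> 'v list \<Rightarrow>\<^sub>0 'k) \<in> boundaries P n"
    unfolding boundaries_def using chains.subspace_0[OF F] chains.subspace_0[OF D] by blast
  fix x :: "'s \<times> 'v list \<Rightarrow>\<^sub>0 'k"
  assume "x \<in> boundaries P n"
  then obtain c d where x: "x = boundary P c + d"
      "c \<in> ordered_chains P (Suc n)" "d \<in> orientation_relations P n"
    by (auto simp: boundaries_def)
  {
    fix y :: "'s \<times> 'v list \<Rightarrow>\<^sub>0 'k"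
    assume "y \<in> boundaries P n"
    then obtain c' d' where y: "y = boundary P c' + d'"
        "c' \<in> ordered_chains P (Suc n)" "d' \<in> orientation_relations P n"
      by (auto simp: boundaries_def)
    have "x + y = boundary P (c + c') + (d + d')"
      using x y by (simp add: boundary_def chain_extend_add)
    then show "x + y \<in> boundaries P n"
      unfolding boundaries_def
      using chains.subspace_add[OF F x(2) y(2)] chains.subspace_add[OF D x(3) y(3)] by blast
  }
  fix r
  have "chain_scale r x = boundary P (chain_scale r c) + chain_scale r d"
    using x by (simp add: boundary_def chain_extend_scale chains.scale_right_distrib)
  then show "chain_scale r x \<in> boundaries P n"
    unfolding boundaries_def
    using chains.subspace_scale[OF F x(2)] chains.subspace_scale[OF D x(3)] by blast
qed

lemma homology_class_eq_iff:
  "homology_class P n a = homology_class P n b \<longleftrightarrow> a - b \<in> boundaries P n"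
proof
  assume "homology_class P n a = homology_class P n b"
  moreover have "a \<in> homology_class P n a"
    using chains.subspace_0[OF subspace_boundaries] by (simp add: homology_class_def)
  ultimately show "a - b \<in> boundaries P n" by (simp add: homology_class_def)
next
  assume ab: "a - b \<in> boundaries P n"
  have "c - a \<in> boundaries P n \<longleftrightarrow> c - b \<in> boundaries P n" for c
    using chains.subspace_add[OF subspace_boundaries _ ab, of "c - a"]
      chains.subspace_diff[OF subspace_boundaries _ ab, of "c - b"] by auto
  then show "homology_class P n a = homology_class P n b" by (simp add: homology_class_def)
qed

lemma homology_class_self: "a \<in> homology_class P n a"
  using chains.subspace_0[OF subspace_boundaries] by (simp add: homology_class_def)

lemma homology_add:
  "add (homology K P n) (homology_class P n a) (homology_class P n b) = homology_class P n (a + b)"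
proof -
  have "homology_class P n (a' + b') = homology_class P n (a + b)"
    if "a' \<in> homology_class P n a" "b' \<in> homology_class P n b" for a' b'
  proof -
    have eq: "(a' + b') - (a + b) = (a' - a) + (b' - b)" by simp
    show ?thesis
      unfolding homology_class_eq_iff eq
      using that chains.subspace_add[OF subspace_boundaries, of "a' - a" P n "b' - b"]
      by (simp add: homology_class_def)
  qed
  then show ?thesis
    unfolding homology_def ring.simps
    by (intro UN_constant_eq[OF homology_class_self] ballI) blast
qed

lemma homology_smult:
  "module.smult (homology K P n) r (homology_class P n a) = homology_class P n (chain_scale r a)"
proof -
  have "homology_class P n (chain_scale r a') = homology_class P n (chain_scale r a)"
    if "a' \<in> homology_class P n a" for a'
  proof -
    have eq: "chain_scale r a' - chain_scale r a = chain_scale r (a' - a)"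
      by (simp add: chains.scale_right_diff_distrib)
    show ?thesis
      unfolding homology_class_eq_iff eq
      using that chains.subspace_scale[OF subspace_boundaries, of "a' - a" P n r]
      by (simp add: homology_class_def)
  qed
  then show ?thesis
    unfolding homology_def module.simps
    by (intro UN_constant_eq[OF homology_class_self] ballI) blast
qed

lemma vectorspace_homology:
  fixes K :: "'k::field itself" and P :: "('s, 'v) scomplex"
  shows "vectorspace class_ring (homology K P n)"
proof -
  let ?H = "homology K P n" and ?cls = "homology_class P n"
  have carr: "carrier ?H = ?cls ` cycles P n" and zero: "zero ?H = ?cls 0"
    by (simp_all add: homology_def)
  have Z: "chains.subspace (cycles P n :: ('s \<times> 'v list \<Rightarrow>\<^sub>0 'k) set)"
    by (rule subspace_cycles)
  have ab: "abelian_group ?H"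
  proof (rule abelian_groupI)
    show "zero ?H \<in> carrier ?H" using chains.subspace_0[OF Z] by (simp add: carr zero)
  next
    fix x y assume "x \<in> carrier ?H" "y \<in> carrier ?H"
    then show "add ?H x y \<in> carrier ?H" "add ?H x y = add ?H y x"
      using chains.subspace_add[OF Z] by (auto simp: carr homology_add add.commute)
  next
    fix x y z assume "x \<in> carrier ?H" "y \<in> carrier ?H" "z \<in> carrier ?H"
    then show "add ?H (add ?H x y) z = add ?H x (add ?H y z)"
      by (auto simp: carr homology_add add.assoc)
  next
    fix x assume x: "x \<in> carrier ?H"
    then show "add ?H (zero ?H) x = x" by (auto simp: carr zero homology_add)
    from x obtain a where a: "a \<in> cycles P n" "x = ?cls a" by (auto simp: carr)
    have "?cls (- a) \<in> carrier ?H" using chains.subspace_neg[OF Z a(1)] by (simp add: carr)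
    moreover have "add ?H (?cls (- a)) x = zero ?H" by (simp add: a zero homology_add)
    ultimately show "\<exists>y\<in>carrier ?H. add ?H y x = zero ?H" by blast
  qed
  have "Module.module class_ring ?H"
    by (rule moduleI[OF class_cring.is_cring ab])
      (use chains.subspace_scale[OF Z] in
        \<open>auto simp: carr homology_add homology_smult
          chains.scale_left_distrib chains.scale_right_distrib\<close>)
  then show ?thesis unfolding vectorspace_def using class_field by blast
qed

end

theory Submission
  imports Defs
begin

text \<open>
  The quotient map from \<open>X\<close> to its Reeb space has connected fibres, and this is enough to lift vertices
  and edges back to \<open>X\<close>.  Choose a basepoint in \<open>X\<close> for every vertex of the Reeb space.
  An edge \<open>C\<close> from \<open>D\<close> to \<open>E\<close> of the Reeb space is represented by an edge \<open>{v, w}\<close> of \<open>X\<close>, and it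
  is lifted to the path that goes from the basepoint of \<open>D\<close> to \<open>v\<close> inside a fibre, crosses
  \<open>{v, w}\<close>, and goes from \<open>w\<close> to the basepoint of \<open>E\<close> inside a fibre (\<open>fibre_path\<close>,
  \<open>edge_lift_exists\<close>).  The fibre parts are mapped to degenerate edges of the Reeb space, which
  vanish in oriented chains, so the path is mapped to \<open>C\<close> itself; and by its choice of end points
  the lift is compatible with boundaries.  This gives linear lifts of chains of degree 0 and 1, which
  are sections of the quotient map up to orientation relations (\<open>reeb_chain_map_vertex_lift\<close>,
  \<open>boundary_edge_lift\<close>, \<open>reeb_chain_map_edge_lift\<close>).

  In degree 0 the lift takes boundaries to boundaries, because the boundary of an edge lifts to the
  boundary of the lifted edge.  It is also a left inverse of the quotient map up to boundaries: a
  vertex and the basepoint of its class are joined by a path in a fibre.  Hence it induces an inverse in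
  homology.

  In degree 1 the lift takes cycles to cycles, which makes the quotient map surjective on \<open>H\<^sub>1\<close>.
  But the lift of the boundary of a triangle need not bound: for the projection of a solid torus,
  triangulated as a product of a circle and a triangle, onto that triangle, it can wind around the
  circle.  The lift itself therefore need not act on homology.  As the
  coefficients form a field, the boundaries have a linear complement, and the lift is
  precomposed with the projection onto that complement, which kills the boundaries and moves every
  chain by a boundary only.  The result induces a linear section of the quotient map on \<open>H\<^sub>1\<close>, and a
  section is injective.
\<close>

section \<open>Linear maps between chain spaces\<close>

abbreviation generator :: "'b \<Rightarrow> ('b \<Rightarrow>\<^sub>0 'k::field)" where
  "generator x \<equiv> Poly_Mapping.single x 1"

abbreviation chain_linear ::
  "(('b \<Rightarrow>\<^sub>0 'k::field) \<Rightarrow> ('c \<Rightarrow>\<^sub>0 'k)) \<Rightarrow> bool" where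
  "chain_linear \<equiv> Vector_Spaces.linear chain_scale chain_scale"

lemma chain_linearI:
  assumes "\<And>c d. \<phi> (c + d) = \<phi> c + \<phi> d" "\<And>r c. \<phi> (chain_scale r c) = chain_scale r (\<phi> c)"
  shows "chain_linear \<phi>"
  unfolding Vector_Spaces.linear_iff
  by (intro conjI allI assms chains.vector_space_axioms)

lemma chain_linear_simps:
  assumes "chain_linear \<phi>"
  shows "\<phi> (c + d) = \<phi> c + \<phi> d" "\<phi> (chain_scale r c) = chain_scale r (\<phi> c)"
    "\<phi> (c - d) = \<phi> c - \<phi> d" "\<phi> 0 = 0"
proof -
  interpret l: Vector_Spaces.linear chain_scale chain_scale \<phi> by fact
  show "\<phi> (c + d) = \<phi> c + \<phi> d" "\<phi> (chain_scale r c) = chain_scale r (\<phi> c)"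
    "\<phi> (c - d) = \<phi> c - \<phi> d" "\<phi> 0 = 0"
    by (rule l.add l.scale l.diff l.zero)+
qed

lemma chain_linear_sum: "chain_linear \<phi> \<Longrightarrow> \<phi> (\<Sum>i\<in>I. c i) = (\<Sum>i\<in>I. \<phi> (c i))"
  using module_hom.sum[of chain_scale chain_scale \<phi>] by (simp add: Vector_Spaces.linear_def)

lemma chain_linear_diff:
  assumes "chain_linear \<phi>" "chain_linear \<psi>"
  shows "chain_linear (\<lambda>c. \<phi> c - \<psi> c)"
  by (rule chain_linearI)
    (simp_all add: chain_linear_simps[OF assms(1)] chain_linear_simps[OF assms(2)]
      chains.scale_right_diff_distrib)

lemma chain_linear_comp:
  assumes "chain_linear \<phi>" "chain_linear \<psi>"
  shows "chain_linear (\<lambda>c. \<phi> (\<psi> c))"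
  by (rule chain_linearI)
    (simp_all add: chain_linear_simps[OF assms(1)] chain_linear_simps[OF assms(2)])

lemma chain_linear_id: "chain_linear (\<lambda>c. c)"
  by (rule chain_linearI) simp_all

lemma chain_linear_extend: "chain_linear (chain_extend \<phi>)"
  by (rule chain_linearI) (rule chain_extend_add chain_extend_scale)+

lemma chain_linear_boundary: "chain_linear (boundary P)"
  unfolding boundary_def by (rule chain_linear_extend)

lemma chain_linear_induced: "chain_linear (induced_chain_map g h)"
  unfolding induced_chain_map_def by (rule chain_linear_extend)

lemma chain_extend_single: "chain_extend \<phi> (Poly_Mapping.single x a) = chain_scale a (\<phi> x)"
  by (simp add: chain_extend_def)

lemma chain_eq_sum_singles:
  fixes c :: "'b \<Rightarrow>\<^sub>0 'k::field"
  shows "c = (\<Sum>x\<in>Poly_Mapping.keys c.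
           chain_scale (Poly_Mapping.lookup c x) (generator x))"
proof (rule poly_mapping_eqI)
  fix y
  have "Poly_Mapping.lookup (\<Sum>x\<in>Poly_Mapping.keys c.
          chain_scale (Poly_Mapping.lookup c x) (generator x)) y
      = (\<Sum>x\<in>Poly_Mapping.keys c. if x = y then Poly_Mapping.lookup c x else 0)"
    unfolding lookup_sum by (rule sum.cong) (simp_all add: lookup_single when_def)
  also have "\<dots> = Poly_Mapping.lookup c y"
    by (simp add: in_keys_iff)
  finally show "Poly_Mapping.lookup c y = Poly_Mapping.lookup (\<Sum>x\<in>Poly_Mapping.keys c.
      chain_scale (Poly_Mapping.lookup c x) (generator x)) y"
    by simp
qed

text \<open>
  Most facts about chains below are checked on generators only and then extended by this lemma.
\<close>

lemma chain_linear_in_subspace: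
  assumes "chain_linear \<phi>" "chains.subspace S"
    and "\<And>x. x \<in> A \<Longrightarrow> \<phi> (generator x) \<in> S" "Poly_Mapping.keys c \<subseteq> A"
  shows "\<phi> c \<in> S"
proof -
  interpret l: Vector_Spaces.linear chain_scale chain_scale \<phi> by fact
  have "\<phi> c = (\<Sum>x\<in>Poly_Mapping.keys c.
      chain_scale (Poly_Mapping.lookup c x) (\<phi> (generator x)))"
    by (subst chain_eq_sum_singles[of c]) (simp add: l.sum l.scale)
  also have "\<dots> \<in> S"
    using assms(2-4) by (intro chains.subspace_sum chains.subspace_scale) blast+
  finally show ?thesis .
qed

lemma chain_linear_eq:
  assumes "chain_linear \<phi>" "chain_linear \<psi>"
    and "\<And>x. x \<in> A \<Longrightarrow> \<phi> (generator x) = \<psi> (generator x)"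
    and "Poly_Mapping.keys c \<subseteq> A"
  shows "\<phi> c = \<psi> c"
  using chain_linear_in_subspace[OF chain_linear_diff[OF assms(1,2)] chains.subspace_single_0 _ assms(4)]
    assms(3) by simp

text \<open>
  The projection is \<open>c \<mapsto> c - g c\<close> for a linear retraction \<open>g\<close> of the whole space onto \<open>B\<close>; it exists
  because the scalars form a field.
\<close>

lemma projection_along_subspace:
  assumes "chains.subspace (B :: ('b \<Rightarrow>\<^sub>0 'k::field) set)"
  obtains \<pi> where "chain_linear \<pi>" "\<And>b. b \<in> B \<Longrightarrow> \<pi> b = 0" "\<And>c. \<pi> c - c \<in> B"
proof -
  interpret vector_space_pair "chain_scale :: 'k \<Rightarrow> ('b \<Rightarrow>\<^sub>0 'k) \<Rightarrow> _"
      "chain_scale :: 'k \<Rightarrow> ('b \<Rightarrow>\<^sub>0 'k) \<Rightarrow> _"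
    by unfold_locales
  obtain g where g: "g ` UNIV \<subseteq> B" "chain_linear g" "\<forall>b\<in>B. g b = b"
    using linear_exists_left_inverse_on[OF chain_linear_id assms] by (auto simp: inj_on_def)
  show ?thesis
  proof
    show "chain_linear (\<lambda>c. c - g c)"
      by (rule chain_linear_diff[OF chain_linear_id g(2)])
    show "b - g b = 0" if "b \<in> B" for b using g(3) that by simp
    show "(c - g c) - c \<in> B" for c
      using chains.subspace_neg[OF assms, of "g c"] g(1) by (simp add: image_subset_iff)
  qed
qed


section \<open>Linear maps between homology groups\<close>

text \<open>
  The form of \<open>homology_map\<close> for an arbitrary map of chains, so that lifts not induced by a map of
  complexes are covered as well.
\<close>

definition class_map ::
  "('t, 'w) scomplex \<Rightarrow> nat \<Rightarrow> (('s \<times> 'v list \<Rightarrow>\<^sub>0 'k::field) \<Rightarrow> ('t \<times> 'w list \<Rightarrow>\<^sub>0 'k)) \<Rightarrow>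
     ('s \<times> 'v list \<Rightarrow>\<^sub>0 'k) set \<Rightarrow> ('t \<times> 'w list \<Rightarrow>\<^sub>0 'k) set" where
  "class_map Q n \<phi> A = (\<Union>a\<in>A. homology_class Q n (\<phi> a))"

lemma class_map_homology_class:
  assumes "chain_linear \<phi>" "\<phi> ` boundaries P n \<subseteq> boundaries Q n"
  shows "class_map Q n \<phi> (homology_class P n z) = homology_class Q n (\<phi> z)"
proof -
  have "homology_class Q n (\<phi> a) = homology_class Q n (\<phi> z)" if "a \<in> homology_class P n z" for a
    using that assms(2)
    unfolding homology_class_eq_iff chain_linear_simps(3)[OF assms(1), symmetric]
    by (auto simp: homology_class_def)
  then show ?thesis
    unfolding class_map_def by (intro UN_constant_eq[OF homology_class_self]) blast
qed

lemma linear_map_class_map: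
  fixes \<phi> :: "('s \<times> 'v list \<Rightarrow>\<^sub>0 'k::field) \<Rightarrow> ('t \<times> 'w list \<Rightarrow>\<^sub>0 'k)" and K :: "'k itself"
  assumes "chain_linear \<phi>" "\<phi> ` boundaries P n \<subseteq> boundaries Q n" "\<phi> ` cycles P n \<subseteq> cycles Q n"
  shows "linear_map class_ring (homology K P n) (homology K Q n) (class_map Q n \<phi>)"
proof -
  note cm = class_map_homology_class[OF assms(1,2)] and lin = chain_linear_simps[OF assms(1)]
  have "class_map Q n \<phi> \<in> LinearCombinations.module_hom class_ring (homology K P n) (homology K Q n)"
    unfolding LinearCombinations.module_hom_def mem_Collect_eq
  proof (intro conjI allI impI funcsetI)
    fix a assume "a \<in> carrier (homology K P n)"
    then show "class_map Q n \<phi> a \<in> carrier (homology K Q n)"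
      using assms(3) by (auto simp: homology_def cm)
  next
    fix a b assume "a \<in> carrier (homology K P n) \<and> b \<in> carrier (homology K P n)"
    then obtain y z where "a = homology_class P n y" "b = homology_class P n z"
      by (auto simp: homology_def)
    then show "class_map Q n \<phi> (a \<oplus>\<^bsub>homology K P n\<^esub> b) =
        class_map Q n \<phi> a \<oplus>\<^bsub>homology K Q n\<^esub> class_map Q n \<phi> b"
      by (simp add: homology_add cm lin)
  next
    fix r :: 'k and a assume "r \<in> carrier class_ring \<and> a \<in> carrier (homology K P n)"
    then obtain z where "a = homology_class P n z"
      by (auto simp: homology_def)
    then show "class_map Q n \<phi> (r \<odot>\<^bsub>homology K P n\<^esub> a) = r \<odot>\<^bsub>homology K Q n\<^esub> class_map Q n \<phi> a"
      by (simp add: homology_smult cm lin)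
  qed
  then show ?thesis
    using vectorspace_homology[of K P n] vectorspace_homology[of K Q n]
    unfolding linear_map_def mod_hom_def mod_hom_axioms_def vectorspace_def by blast
qed

lemma induced_chain_map_single:
  "induced_chain_map g h (Poly_Mapping.single (s, vs) a) = Poly_Mapping.single (g s, map h vs) a"
  by (rule poly_mapping_eqI)
    (simp add: induced_chain_map_def chain_extend_single lookup_single when_def)

lemma boundary_single:
  "boundary P (generator x) = boundary_simplex P x"
  by (simp add: boundary_def chain_extend_single)

lemma map_remove_nth: "map h (remove_nth i vs) = remove_nth i (map h vs)"
  by (simp add: remove_nth_def take_map drop_map)

lemma length_remove_nth: "i < length vs \<Longrightarrow> length (remove_nth i vs) = length vs - 1"
  by (simp add: remove_nth_def)

lemma set_remove_nth_subset: "set (remove_nth i vs) \<subseteq> set vs"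
  by (auto simp: remove_nth_def dest: in_set_takeD in_set_dropD)

text \<open>
  A map of complexes may identify vertices of a simplex.  The chain complex admits listings with
  repetitions, so that its chain map commutes with boundaries even before the
  orientation relations are divided out.
\<close>

context
  fixes P :: "('s, 'v) scomplex" and Q :: "('t, 'w) scomplex"
    and g :: "'s \<Rightarrow> 't" and h :: "'v \<Rightarrow> 'w"
  assumes map: "generalized_map P Q g h"
begin

lemma induced_ordered_simplices:
  "(s, vs) \<in> ordered_simplices P n \<Longrightarrow> (g s, map h vs) \<in> ordered_simplices Q n"
  using map by (auto simp: generalized_map_def ordered_simplices_def)

lemma induced_ordered_chains:
  assumes "c \<in> ordered_chains P n"
  shows "induced_chain_map g h c \<in> ordered_chains Q n"
proof (rule chain_linear_in_subspace[OF chain_linear_induced subspace_ordered_chains])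
  show "Poly_Mapping.keys c \<subseteq> ordered_simplices P n" using assms by (simp add: ordered_chains_def)
  show "induced_chain_map g h (generator x) \<in> ordered_chains Q n"
    if "x \<in> ordered_simplices P n" for x
    using that induced_ordered_simplices
    by (cases x) (auto simp: induced_chain_map_single ordered_chains_def)
qed

lemma induced_boundary:
  fixes c :: "'s \<times> 'v list \<Rightarrow>\<^sub>0 'k::field"
  assumes "c \<in> ordered_chains P n"
  shows "boundary Q (induced_chain_map g h c) = induced_chain_map g h (boundary P c)"
proof (rule chain_linear_eq[of "\<lambda>c. boundary Q (induced_chain_map g h c)"
      "\<lambda>c. induced_chain_map g h (boundary P c)"])
  show "Poly_Mapping.keys c \<subseteq> ordered_simplices P n" using assms by (simp add: ordered_chains_def)
  fix x assume x: "x \<in> ordered_simplices P n"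
  obtain s vs where sv: "x = (s, vs)" "s \<in> simplices P" "set vs = verts P s"
    using x by (auto simp: ordered_simplices_def)
  have face: "g (face P s (set (remove_nth i vs))) = face Q (g s) (set (remove_nth i (map h vs)))"
    if "i < length vs" "\<not> length vs \<le> 1" for i
  proof -
    have "set (remove_nth i vs) \<subseteq> verts P s" using set_remove_nth_subset sv by metis
    moreover have "remove_nth i vs \<noteq> []" using length_remove_nth[OF that(1)] that(2) by auto
    ultimately show ?thesis
      using map sv by (simp add: generalized_map_def map_remove_nth[symmetric])
  qed
  show "boundary Q (induced_chain_map g h (generator x :: _ \<Rightarrow>\<^sub>0 'k)) =
      induced_chain_map g h (boundary P (generator x))"
  proof (cases "length vs \<le> 1")
    case True
    then show ?thesis
      by (simp add: sv induced_chain_map_single boundary_single boundary_simplex_def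
          chain_linear_simps(4)[OF chain_linear_induced])
  next
    case False
    have "induced_chain_map g h (boundary P (generator x :: _ \<Rightarrow>\<^sub>0 'k)) =
        (\<Sum>i<length vs. induced_chain_map g h (Poly_Mapping.single
           (face P s (set (remove_nth i vs)), remove_nth i vs) ((- 1) ^ i)))"
      unfolding boundary_single sv boundary_simplex_def using False
      by (simp add: chain_linear_sum[OF chain_linear_induced])
    also have "\<dots> = (\<Sum>i<length (map h vs). Poly_Mapping.single
           (face Q (g s) (set (remove_nth i (map h vs))), remove_nth i (map h vs)) ((- 1) ^ i))"
      unfolding induced_chain_map_single length_map
    proof (rule sum.cong[OF refl])
      fix i assume "i \<in> {..<length vs}"
      then have i: "i < length vs" by simp
      show "Poly_Mapping.single (g (face P s (set (remove_nth i vs))), map h (remove_nth i vs)) ((- 1) ^ i) =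
          Poly_Mapping.single (face Q (g s) (set (remove_nth i (map h vs))), remove_nth i (map h vs))
            ((- 1 :: 'k) ^ i)"
        unfolding face[OF i False] map_remove_nth ..
    qed
    also have "\<dots> = boundary Q (induced_chain_map g h (generator x))"
      unfolding sv induced_chain_map_single boundary_single boundary_simplex_def using False by simp
    finally show ?thesis by (rule sym)
  qed
qed (rule chain_linear_comp[OF chain_linear_boundary chain_linear_induced]
    chain_linear_comp[OF chain_linear_induced chain_linear_boundary])+

lemma induced_orientation_relations:
  assumes "c \<in> orientation_relations P n"
  shows "induced_chain_map g h c \<in> orientation_relations Q n"
  using assms unfolding orientation_relations_def[of P]
proof (induction rule: chains.span_induct_alt)
  note lin = chain_linear_simps[OF chain_linear_induced]
  case base
  show ?case
    unfolding lin by (rule chains.subspace_0[OF subspace_orientation_relations])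
next
  note lin = chain_linear_simps[OF chain_linear_induced]
  case (step r x y)
  have "induced_chain_map g h x \<in> orientation_relations Q n"
    using step(1)
  proof (elim UnE CollectE exE conjE)
    fix s vs assume x: "x = generator (s, vs)"
      and "(s, vs) \<in> ordered_simplices P n" "\<not> distinct vs"
    then have "(g s, map h vs) \<in> ordered_simplices Q n" "\<not> distinct (map h vs)"
      using induced_ordered_simplices by (simp_all add: distinct_map)
    then show ?thesis
      unfolding x induced_chain_map_single orientation_relations_def
      by (intro chains.span_base UnI1 CollectI exI conjI) (rule refl, assumption+)
  next
    fix s vs i j
    assume x: "x = generator (s, vs) +
        generator (s, vs[i := vs ! j, j := vs ! i])"
      and s: "(s, vs) \<in> ordered_simplices P n" "i < j" "j < length vs"
    have "induced_chain_map g h x = generator (g s, map h vs) +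
        generator (g s, (map h vs)[i := map h vs ! j, j := map h vs ! i])"
      unfolding x lin induced_chain_map_single using s by (simp add: map_update)
    moreover have "(g s, map h vs) \<in> ordered_simplices Q n" "j < length (map h vs)"
      using s induced_ordered_simplices by simp_all
    ultimately show ?thesis
      using s(2) unfolding orientation_relations_def
      by (intro chains.span_base UnI2 CollectI exI conjI) (assumption, assumption?)+
  qed
  then show ?case
    unfolding lin using step(2) subspace_orientation_relations
    by (intro chains.subspace_add chains.subspace_scale)
qed

lemma induced_cycles: "induced_chain_map g h ` cycles P n \<subseteq> cycles Q n"
  by (auto simp: cycles_def induced_boundary
      intro: induced_ordered_chains induced_orientation_relations)

lemma induced_boundaries: "induced_chain_map g h ` boundaries P n \<subseteq> boundaries Q n"
proof
  fix y assume "y \<in> induced_chain_map g h ` boundaries P n"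
  then obtain c d where y: "y = induced_chain_map g h (boundary P c + d)"
      "c \<in> ordered_chains P (Suc n)" "d \<in> orientation_relations P n"
    by (auto simp: boundaries_def)
  then have "y = boundary Q (induced_chain_map g h c) + induced_chain_map g h d"
    by (simp add: chain_linear_simps[OF chain_linear_induced] induced_boundary)
  then show "y \<in> boundaries Q n"
    unfolding boundaries_def
    using induced_ordered_chains[OF y(2)] induced_orientation_relations[OF y(3)] by blast
qed

end


section \<open>Chains of degree at most one\<close>

lemma orientation_relations_0: "orientation_relations P 0 = {0}"
proof -
  have "distinct vs" "\<not> (i < j \<and> j < length vs)" if "(s, vs) \<in> ordered_simplices P 0" for s vs i j
  proof -
    have len: "length vs = Suc 0" using that by (simp add: ordered_simplices_def)
    then show "distinct vs" by (cases vs) simp_all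
    show "\<not> (i < j \<and> j < length vs)" unfolding len by simp
  qed
  then have "orientation_relations P 0 = chains.span {}"
    unfolding orientation_relations_def by (intro arg_cong[where f = chains.span]) blast
  then show ?thesis by (simp only: chains.span_empty)
qed

lemma orientation_relations_subset_boundaries: "orientation_relations P n \<subseteq> boundaries P n"
proof
  fix d assume d: "d \<in> orientation_relations P n"
  have "d = boundary P 0 + d" by (simp add: chain_linear_simps[OF chain_linear_boundary])
  then show "d \<in> boundaries P n"
    unfolding boundaries_def using d chains.subspace_0[OF subspace_ordered_chains] by blast
qed

lemma orientation_relations_subset_ordered_chains: "orientation_relations P n \<subseteq> ordered_chains P n"
  unfolding orientation_relations_def
proof (rule chains.span_minimal[OF _ subspace_ordered_chains], rule subsetI, elim UnE CollectE exE conjE)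
  fix x :: "_ \<Rightarrow>\<^sub>0 'k::field" and s vs
  assume "x = generator (s, vs)" "(s, vs) \<in> ordered_simplices P n"
  then show "x \<in> ordered_chains P n" by (simp add: ordered_chains_def)
next
  fix x :: "_ \<Rightarrow>\<^sub>0 'k::field" and s vs i j
  assume x: "x = generator (s, vs) +
      generator (s, vs[i := vs ! j, j := vs ! i])"
    and vs: "(s, vs) \<in> ordered_simplices P n" "i < j" "j < length vs"
  have "(s, vs[i := vs ! j, j := vs ! i]) \<in> ordered_simplices P n"
    using vs by (simp add: ordered_simplices_def set_swap)
  then show "x \<in> ordered_chains P n"
    unfolding x using vs(1)
    by (intro chains.subspace_add[OF subspace_ordered_chains]) (simp_all add: ordered_chains_def)
qed

lemma boundary_in_boundaries:
  assumes "c \<in> ordered_chains P (Suc n)"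
  shows "boundary P c \<in> boundaries P n"
proof -
  have "boundary P c = boundary P c + 0" by simp
  then show ?thesis
    unfolding boundaries_def
    using assms chains.subspace_0[OF subspace_orientation_relations] by blast
qed

lemma boundary_0:
  fixes c :: "'s \<times> 'v list \<Rightarrow>\<^sub>0 'k::field"
  assumes "c \<in> ordered_chains P 0"
  shows "boundary P c = 0"
proof -
  have "boundary P c \<in> {0}"
  proof (rule chain_linear_in_subspace[OF chain_linear_boundary chains.subspace_single_0])
    show "Poly_Mapping.keys c \<subseteq> ordered_simplices P 0"
      using assms by (simp add: ordered_chains_def)
    show "boundary P (generator x :: _ \<Rightarrow>\<^sub>0 'k) \<in> {0}" if "x \<in> ordered_simplices P 0" for x
      using that by (cases x) (simp add: ordered_simplices_def boundary_single boundary_simplex_def)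
  qed
  then show ?thesis by simp
qed

lemma cycles_0: "cycles P 0 = ordered_chains P 0"
  by (auto simp: cycles_def orientation_relations_0 boundary_0)

lemma boundary_edge:
  "boundary P (generator (s, [v, w])) =
     generator (face P s {w}, [w]) - generator (face P s {v}, [v])"
  by (simp add: boundary_single boundary_simplex_def remove_nth_def numeral_2_eq_2 single_uminus)


lemma boundary_triangle:
  "boundary P (generator (s, [u, v, w])) =
     generator (face P s {v, w}, [v, w]) -
     generator (face P s {u, w}, [u, w]) +
     generator (face P s {u, v}, [u, v])"
  by (simp add: boundary_single boundary_simplex_def remove_nth_def numeral_2_eq_2 single_uminus insert_commute)

text \<open>
  In a generalised complex the two ways of passing from a triangle to one of its vertices give the same
  simplex, since a face of a face is a face.  The six terms then cancel in pairs.
\<close>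

lemma boundary_boundary_2:
  fixes c :: "'s \<times> 'v list \<Rightarrow>\<^sub>0 'k::field"
  assumes P: "generalized_complex P" and c: "c \<in> ordered_chains P 2"
  shows "boundary P (boundary P c) = 0"
proof -
  have "boundary P (boundary P c) \<in> {0}"
  proof (rule chain_linear_in_subspace[OF
        chain_linear_comp[OF chain_linear_boundary chain_linear_boundary] chains.subspace_single_0])
    show "Poly_Mapping.keys c \<subseteq> ordered_simplices P 2"
      using c by (simp add: ordered_chains_def)
    fix x assume "x \<in> ordered_simplices P 2"
    then obtain s u v w where x: "x = (s, [u, v, w])"
      and s: "s \<in> simplices P" "verts P s = {u, v, w}"
      by (cases x) (auto simp: ordered_simplices_def numeral_2_eq_2 length_Suc_conv)
    have "face P (face P s W) {a} = face P s {a}" if "W \<subseteq> {u, v, w}" "a \<in> W" for W a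
    proof -
      have "W \<subseteq> verts P s" "W \<noteq> {}" "{a} \<subseteq> W" "{a} \<noteq> {}" using that s by auto
      then show ?thesis using P s(1) unfolding generalized_complex_def by blast
    qed
    then show "boundary P (boundary P (generator x :: _ \<Rightarrow>\<^sub>0 'k)) \<in> {0}"
      by (simp add: x boundary_triangle chain_linear_simps[OF chain_linear_boundary] boundary_edge)
  qed
  then show ?thesis by simp
qed

text \<open>
  For the listing \<open>[v, v]\<close> the two end points cancel, and reversing \<open>[v, w]\<close> exchanges them.
\<close>

lemma boundary_orientation_relations_1:
  assumes "d \<in> orientation_relations P 1"
  shows "boundary P d = 0"
  using assms unfolding orientation_relations_def
proof (induction rule: chains.span_induct_alt)
  case base
  show ?case by (rule chain_linear_simps(4)[OF chain_linear_boundary])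
next
  case (step r x y)
  have edge: "\<exists>v w. vs = [v, w]" if "(s, vs) \<in> ordered_simplices P 1" for s vs
    using that by (auto simp: ordered_simplices_def length_Suc_conv)
  have "boundary P x = 0"
    using step(1)
  proof (elim UnE CollectE exE conjE)
    fix s vs assume x: "x = generator (s, vs)"
      and vs: "(s, vs) \<in> ordered_simplices P 1" "\<not> distinct vs"
    obtain v where "vs = [v, v]" using edge[OF vs(1)] vs(2) by auto
    then show ?thesis by (simp add: x boundary_edge)
  next
    fix s vs i j
    assume x: "x = generator (s, vs) +
        generator (s, vs[i := vs ! j, j := vs ! i])"
      and vs: "(s, vs) \<in> ordered_simplices P 1" "i < j" "j < length vs"
    obtain v w where vw: "vs = [v, w]" using edge[OF vs(1)] by blast
    have "i = 0" "j = 1" using vs(2,3) vw by auto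
    then show ?thesis
      by (simp add: x vw chain_linear_simps[OF chain_linear_boundary] boundary_edge)
  qed
  then show ?case by (simp add: step(2) chain_linear_simps[OF chain_linear_boundary])
qed

lemma boundary_ordered_chains:
  fixes c :: "'s \<times> 'v list \<Rightarrow>\<^sub>0 'k::field"
  assumes P: "generalized_complex P" and c: "c \<in> ordered_chains P (Suc n)"
  shows "boundary P c \<in> ordered_chains P n"
proof (rule chain_linear_in_subspace[OF chain_linear_boundary subspace_ordered_chains])
  show "Poly_Mapping.keys c \<subseteq> ordered_simplices P (Suc n)"
    using c by (simp add: ordered_chains_def)
  fix x assume "x \<in> ordered_simplices P (Suc n)"
  then obtain s vs where x: "x = (s, vs)"
    and s: "s \<in> simplices P" "length vs = Suc (Suc n)" "set vs = verts P s"
    by (cases x) (auto simp: ordered_simplices_def)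
  have "Poly_Mapping.single (face P s (set (remove_nth i vs)), remove_nth i vs) ((- 1 :: 'k) ^ i)
      \<in> ordered_chains P n" if "i < length vs" for i
  proof -
    have len: "length (remove_nth i vs) = Suc n"
      using length_remove_nth[OF that] s(2) by simp
    then have "set (remove_nth i vs) \<noteq> {}" by auto
    moreover have "set (remove_nth i vs) \<subseteq> verts P s"
      using set_remove_nth_subset s(3) by metis
    ultimately have "(face P s (set (remove_nth i vs)), remove_nth i vs) \<in> ordered_simplices P n"
      using P s(1) len unfolding generalized_complex_def ordered_simplices_def by simp
    then show ?thesis by (simp add: ordered_chains_def)
  qed
  then show "boundary P (generator x :: _ \<Rightarrow>\<^sub>0 'k) \<in> ordered_chains P n"
    unfolding boundary_single x boundary_simplex_def split
    by (auto intro!: chains.subspace_sum[OF subspace_ordered_chains]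
        chains.subspace_0[OF subspace_ordered_chains])
qed

lemma boundaries_1_subset_cycles:
  assumes P: "generalized_complex P"
  shows "boundaries P 1 \<subseteq> cycles P 1"
proof
  fix b :: "_ \<Rightarrow>\<^sub>0 'k::field" assume "b \<in> boundaries P 1"
  then obtain c d where b: "b = boundary P c + d"
      and c: "c \<in> ordered_chains P 2" and d: "d \<in> orientation_relations P 1"
    by (auto simp: boundaries_def numeral_2_eq_2)
  have "boundary P c \<in> ordered_chains P 1"
    using boundary_ordered_chains[OF P, of c 1] c by (simp add: numeral_2_eq_2)
  moreover have "d \<in> ordered_chains P 1"
    by (rule subsetD[OF orientation_relations_subset_ordered_chains d])
  moreover have "boundary P b = 0"
    unfolding b chain_linear_simps[OF chain_linear_boundary]
    using boundary_boundary_2[OF P c] boundary_orientation_relations_1[OF d] by simp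
  ultimately show "b \<in> cycles P 1"
    using chains.subspace_add[OF subspace_ordered_chains]
    by (simp add: b cycles_def orientation_relations_0)
qed


section \<open>Lifting vertices and edges from the Reeb space\<close>

abbreviation reeb_chain_map ::
  "'a set set \<Rightarrow> ('a \<Rightarrow> 'b) \<Rightarrow>
     ('a set \<times> 'a list \<Rightarrow>\<^sub>0 'k::field) \<Rightarrow> ('a set set \<times> 'a set set list \<Rightarrow>\<^sub>0 'k)" where
  "reeb_chain_map X f \<equiv> induced_chain_map (reeb_class X f) (reeb_vertex X f)"

definition reeb_basepoint :: "'a set set \<Rightarrow> ('a \<Rightarrow> 'b) \<Rightarrow> 'a set set \<Rightarrow> 'a" where
  "reeb_basepoint X f D = (SOME v. {v} \<in> X \<and> reeb_vertex X f v = D)"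

definition point_chain :: "'a \<Rightarrow> ('a set \<times> 'a list \<Rightarrow>\<^sub>0 'k::field)" where
  "point_chain v = generator ({v}, [v])"

definition vertex_lift ::
  "'a set set \<Rightarrow> ('a \<Rightarrow> 'b) \<Rightarrow>
     ('a set set \<times> 'a set set list \<Rightarrow>\<^sub>0 'k::field) \<Rightarrow> ('a set \<times> 'a list \<Rightarrow>\<^sub>0 'k)" where
  "vertex_lift X f = chain_extend (\<lambda>(C, Ds). point_chain (reeb_basepoint X f (hd Ds)))"

text \<open>
  The three conditions on the chosen chain are the ones by which the lift of an edge is used; the chain
  is otherwise arbitrary, and it exists for every listed edge of the Reeb space.
\<close>

definition edge_lift ::
  "'a set set \<Rightarrow> ('a \<Rightarrow> 'b) \<Rightarrow>
     ('a set set \<times> 'a set set list \<Rightarrow>\<^sub>0 'k::field) \<Rightarrow> ('a set \<times> 'a list \<Rightarrow>\<^sub>0 'k)" where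
  "edge_lift X f = chain_extend (\<lambda>e. SOME p.
     p \<in> ordered_chains (ordinary X) 1 \<and>
     boundary (ordinary X) p = vertex_lift X f (boundary (reeb_space X f) (generator e)) \<and>
     reeb_chain_map X f p - generator e \<in> orientation_relations (reeb_space X f) 1)"

lemma ordered_simplices_edge:
  "(s, [v, w]) \<in> ordered_simplices P (Suc 0) \<longleftrightarrow> s \<in> simplices P \<and> verts P s = {v, w}"
  by (auto simp: ordered_simplices_def)

lemma ordered_simplices_vertex:
  "(s, [v]) \<in> ordered_simplices P 0 \<longleftrightarrow> s \<in> simplices P \<and> verts P s = {v}"
  by (auto simp: ordered_simplices_def)

lemma generator_in_ordered_chains [simp]:
  "(generator x :: _ \<Rightarrow>\<^sub>0 'k::field) \<in> ordered_chains P n \<longleftrightarrow> x \<in> ordered_simplices P n"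
  by (simp add: ordered_chains_def)

lemma degenerate_edge_relation:
  assumes "s \<in> simplices P" "verts P s = {v}"
  shows "generator (s, [v, v]) \<in> orientation_relations P 1"
  unfolding orientation_relations_def
proof (intro chains.span_base UnI1 CollectI exI conjI)
  show "(s, [v, v]) \<in> ordered_simplices P 1" using assms by (simp add: ordered_simplices_edge)
qed simp_all

context
  fixes X :: "'a set set" and f :: "'a \<Rightarrow> 'b"
  assumes X: "simplicial_complex X"
begin

lemma edge_chain:
  assumes "{v, w} \<in> X"
  shows "generator ({v, w}, [v, w]) \<in> ordered_chains (ordinary X) 1"
    and "boundary (ordinary X) (generator ({v, w}, [v, w])) = point_chain w - point_chain v"
  using assms
  by (simp_all add: ordered_simplices_edge boundary_edge point_chain_def) (simp_all add: ordinary_def)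

lemma reeb_class_edge:
  assumes "{v, w} \<in> X"
  shows "reeb_class X f {v, w} \<in> simplices (reeb_space X f)"
    and "verts (reeb_space X f) (reeb_class X f {v, w}) = {reeb_vertex X f v, reeb_vertex X f w}"
  using assms verts_reeb_class[OF X assms] by (simp_all add: simplices_reeb_space[OF X])

text \<open>
  Connected components of a fibre are generated by the incidence of open simplices, so the path is built by
  induction along a chain of incident simplices in the fibre over a vertex.  Passing from \<open>\<rho>\<close> to a
  larger simplex adds at most one edge, from some vertex of \<open>\<rho>\<close> to \<open>v\<close>; passing to a smaller one adds
  nothing.  All these edges are contracted by \<open>f\<close>, so in the Reeb space they become degenerate.
\<close>

lemma fibre_path:
  assumes "({u}, \<sigma>) \<in> reeb_equiv X f" "v \<in> \<sigma>"
  shows "\<exists>p :: _ \<Rightarrow>\<^sub>0 'k::field. p \<in> ordered_chains (ordinary X) 1 \<and>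
     boundary (ordinary X) p = point_chain v - point_chain u \<and>
     reeb_chain_map X f p \<in> orientation_relations (reeb_space X f) 1"
  using assms
proof (induction arbitrary: v rule: reeb_equiv_induct)
  case refl
  then have "v = u" by simp
  moreover have "(0 :: _ \<Rightarrow>\<^sub>0 'k) \<in> ordered_chains (ordinary X) 1"
    by (rule chains.subspace_0[OF subspace_ordered_chains])
  moreover have "0 \<in> orientation_relations (reeb_space X f) 1"
    by (rule chains.subspace_0[OF subspace_orientation_relations])
  ultimately show ?case
    by (intro exI[of _ 0])
      (simp add: chain_linear_simps(4)[OF chain_linear_boundary]
        chain_linear_simps(4)[OF chain_linear_induced])
next
  case (step \<rho> \<rho>')
  show ?case
  proof (cases "v \<in> \<rho>")
    case True
    then show ?thesis by (rule step.IH)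
  next
    case False
    then have sub: "\<rho> \<subseteq> \<rho>'" using step by blast
    have "\<rho> \<noteq> {}" using X step(1) by (simp add: simplicial_complex_def)
    then obtain w where w: "w \<in> \<rho>" by blast
    obtain p :: "_ \<Rightarrow>\<^sub>0 'k" where p: "p \<in> ordered_chains (ordinary X) 1"
        "boundary (ordinary X) p = point_chain w - point_chain u"
        "reeb_chain_map X f p \<in> orientation_relations (reeb_space X f) 1"
      using step.IH[OF w] by blast
    have wv: "{w, v} \<in> X"
      using w sub step.prems by (intro subface[OF X step(2)]) auto
    have "f w = f v"
    proof -
      have "f w \<in> f ` {u}" "f v \<in> f ` {u}"
        using imageI[OF w, of f] imageI[OF step.prems, of f] step(3,4) by simp_all
      then show ?thesis by simp
    qed
    then have same: "reeb_vertex X f w = reeb_vertex X f v"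
      using w sub step by (subst reeb_vertex_eq_iff[OF X step(2)]) auto
    let ?e = "generator ({w, v}, [w, v]) :: _ \<Rightarrow>\<^sub>0 'k"
    have e: "reeb_chain_map X f ?e \<in> orientation_relations (reeb_space X f) 1"
      using degenerate_edge_relation[of "reeb_class X f {w, v}" "reeb_space X f"]
        reeb_class_edge[OF wv]
      by (simp add: induced_chain_map_single same)
    show ?thesis
    proof (intro exI[of _ "p + ?e"] conjI)
      show "p + ?e \<in> ordered_chains (ordinary X) 1"
        by (intro chains.subspace_add[OF subspace_ordered_chains] p edge_chain wv)
      show "boundary (ordinary X) (p + ?e) = point_chain v - point_chain u"
        by (simp add: chain_linear_simps[OF chain_linear_boundary] p edge_chain wv)
      show "reeb_chain_map X f (p + ?e) \<in> orientation_relations (reeb_space X f) 1"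
        unfolding chain_linear_simps[OF chain_linear_induced]
        by (intro chains.subspace_add[OF subspace_orientation_relations] p e)
    qed
  qed
qed

lemma fibre_path_vertices:
  assumes "{u} \<in> X" "{v} \<in> X" "reeb_vertex X f u = reeb_vertex X f v"
  obtains p :: "_ \<Rightarrow>\<^sub>0 'k::field" where "p \<in> ordered_chains (ordinary X) 1"
    "boundary (ordinary X) p = point_chain v - point_chain u"
    "reeb_chain_map X f p \<in> orientation_relations (reeb_space X f) 1"
  using fibre_path[of u "{v}" v] assms reeb_class_eq_iff[OF assms(1,2)]
  unfolding reeb_vertex_def by blast

lemma reeb_basepoint:
  assumes "{v} \<in> X"
  shows "{reeb_basepoint X f (reeb_vertex X f v)} \<in> X"
    and "reeb_vertex X f (reeb_basepoint X f (reeb_vertex X f v)) = reeb_vertex X f v"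
proof -
  have "\<exists>u. {u} \<in> X \<and> reeb_vertex X f u = reeb_vertex X f v"
    using assms by blast
  from someI_ex[OF this] show "{reeb_basepoint X f (reeb_vertex X f v)} \<in> X"
    "reeb_vertex X f (reeb_basepoint X f (reeb_vertex X f v)) = reeb_vertex X f v"
    unfolding reeb_basepoint_def by blast+
qed

lemma vertex_lift_generator:
  "vertex_lift X f (generator (C, [D])) = point_chain (reeb_basepoint X f D)"
  by (simp add: vertex_lift_def chain_extend_single)

lemma chain_linear_vertex_lift: "chain_linear (vertex_lift X f)"
  unfolding vertex_lift_def by (rule chain_linear_extend)

lemma chain_linear_edge_lift: "chain_linear (edge_lift X f)"
  unfolding edge_lift_def by (rule chain_linear_extend)

lemma reeb_vertex_cases:
  assumes "x \<in> ordered_simplices (reeb_space X f) 0"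
  obtains v where "{v} \<in> X" "x = (reeb_vertex X f v, [reeb_vertex X f v])"
proof -
  obtain C Ds where x: "x = (C, Ds)" "C \<in> simplices (reeb_space X f)" "length Ds = 1"
      "set Ds = verts (reeb_space X f) C"
    using assms by (cases x) (simp add: ordered_simplices_def)
  then obtain D where D: "Ds = [D]" by (auto simp: length_Suc_conv)
  obtain \<sigma> where \<sigma>: "\<sigma> \<in> X" "C = reeb_class X f \<sigma>"
    using x(2) by (auto simp: simplices_reeb_space[OF X])
  have img: "{D} = reeb_vertex X f ` \<sigma>"
    using x(4) unfolding \<sigma>(2) verts_reeb_class[OF X \<sigma>(1)] D by simp
  then obtain v where v: "v \<in> \<sigma>" "D = reeb_vertex X f v" by blast
  have vX: "{v} \<in> X" using v(1) by (intro subface[OF X \<sigma>(1)]) auto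
  have "face (reeb_space X f) C (verts (reeb_space X f) C) = C"
    using generalized_complex_reeb_space[OF X, of f] x(2) by (simp add: generalized_complex_def)
  moreover have "verts (reeb_space X f) C = reeb_vertex X f ` {v}"
    using x(4) D v by simp
  ultimately have "C = reeb_vertex X f v"
    using face_reeb_class[OF X vX \<sigma>(1), of f] v(1) \<sigma>(2) by (simp add: reeb_vertex_def)
  then show ?thesis using that[OF vX] x(1) D v(2) by simp
qed

text \<open>
  A class \<open>C\<close> with vertices \<open>D\<close> and \<open>E\<close> may contain simplices of many dimensions.  In any
  representative, a vertex over \<open>D\<close> and one over \<open>E\<close> span an edge whose class is the face of \<open>C\<close>
  spanned by all its vertices, that is \<open>C\<close>.  For \<open>D = E\<close> the edge may degenerate to a vertex, \<open>v = w\<close>.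
\<close>

lemma reeb_edge_cases:
  assumes "x \<in> ordered_simplices (reeb_space X f) 1"
  obtains v w where "{v, w} \<in> X"
    "x = (reeb_class X f {v, w}, [reeb_vertex X f v, reeb_vertex X f w])"
proof -
  obtain C Ds where x: "x = (C, Ds)" "C \<in> simplices (reeb_space X f)" "length Ds = 2"
      "set Ds = verts (reeb_space X f) C"
    using assms by (cases x) (simp add: ordered_simplices_def)
  then obtain D E where DE: "Ds = [D, E]" by (auto simp: length_Suc_conv numeral_2_eq_2)
  obtain \<sigma> where \<sigma>: "\<sigma> \<in> X" "C = reeb_class X f \<sigma>"
    using x(2) by (auto simp: simplices_reeb_space[OF X])
  have img: "{D, E} = reeb_vertex X f ` \<sigma>"
    using x(4) unfolding \<sigma>(2) verts_reeb_class[OF X \<sigma>(1)] DE by simp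
  have "D \<in> reeb_vertex X f ` \<sigma>" "E \<in> reeb_vertex X f ` \<sigma>"
    unfolding img[symmetric] by simp_all
  then obtain v w where vw: "v \<in> \<sigma>" "D = reeb_vertex X f v" "w \<in> \<sigma>" "E = reeb_vertex X f w"
    by (elim imageE) simp
  have vwX: "{v, w} \<in> X" using vw by (intro subface[OF X \<sigma>(1)]) auto
  have "face (reeb_space X f) C (verts (reeb_space X f) C) = C"
    using generalized_complex_reeb_space[OF X, of f] x(2) by (simp add: generalized_complex_def)
  moreover have "verts (reeb_space X f) C = reeb_vertex X f ` {v, w}"
    using x(4) DE vw by simp
  ultimately have "C = reeb_class X f {v, w}"
    using face_reeb_class[OF X vwX \<sigma>(1), of f] vw \<sigma>(2) by simp
  then show ?thesis using that[OF vwX] x(1) DE vw by simp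
qed

lemma boundary_reeb_edge:
  assumes "{v, w} \<in> X"
  shows "boundary (reeb_space X f)
       (generator (reeb_class X f {v, w}, [reeb_vertex X f v, reeb_vertex X f w])) =
     generator (reeb_vertex X f w, [reeb_vertex X f w]) -
     generator (reeb_vertex X f v, [reeb_vertex X f v])"
proof -
  have "face (reeb_space X f) (reeb_class X f {v, w}) {reeb_vertex X f u} = reeb_vertex X f u"
    if "u \<in> {v, w}" for u
    using face_reeb_class[OF X _ assms, of "{u}" f] subface[OF X assms, of "{u}"] that
    by (simp add: reeb_vertex_def)
  then show ?thesis by (simp add: boundary_edge)
qed

text \<open>
  The lift is the sum of a fibre path \<open>p\<close> from the basepoint to \<open>v\<close>, the edge from \<open>v\<close> to \<open>w\<close>, and
  a fibre path \<open>r\<close> from \<open>w\<close> to the other basepoint.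
\<close>

lemma edge_lift_exists:
  assumes "e \<in> ordered_simplices (reeb_space X f) 1"
  shows "\<exists>p :: _ \<Rightarrow>\<^sub>0 'k::field. p \<in> ordered_chains (ordinary X) 1 \<and>
     boundary (ordinary X) p = vertex_lift X f (boundary (reeb_space X f) (generator e)) \<and>
     reeb_chain_map X f p - generator e \<in> orientation_relations (reeb_space X f) 1"
proof -
  obtain v w where vw: "{v, w} \<in> X"
    and e: "e = (reeb_class X f {v, w}, [reeb_vertex X f v, reeb_vertex X f w])"
    using reeb_edge_cases[OF assms] .
  have v: "{v} \<in> X" and w: "{w} \<in> X" using subface[OF X vw] by simp_all
  let ?base = "\<lambda>u. reeb_basepoint X f (reeb_vertex X f u)"
  obtain p :: "_ \<Rightarrow>\<^sub>0 'k" where p: "p \<in> ordered_chains (ordinary X) 1"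
      "boundary (ordinary X) p = point_chain v - point_chain (?base v)"
      "reeb_chain_map X f p \<in> orientation_relations (reeb_space X f) 1"
    using fibre_path_vertices[OF reeb_basepoint(1)[OF v] v reeb_basepoint(2)[OF v]] .
  obtain r :: "_ \<Rightarrow>\<^sub>0 'k" where r: "r \<in> ordered_chains (ordinary X) 1"
      "boundary (ordinary X) r = point_chain (?base w) - point_chain w"
      "reeb_chain_map X f r \<in> orientation_relations (reeb_space X f) 1"
    using fibre_path_vertices[OF w reeb_basepoint(1)[OF w] reeb_basepoint(2)[OF w, symmetric]] .
  let ?e = "generator ({v, w}, [v, w]) :: _ \<Rightarrow>\<^sub>0 'k"
  note bd = chain_linear_simps[OF chain_linear_boundary]
    and q = chain_linear_simps[OF chain_linear_induced]
  show ?thesis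
  proof (intro exI[of _ "p + ?e + r"] conjI)
    show "p + ?e + r \<in> ordered_chains (ordinary X) 1"
      by (intro chains.subspace_add[OF subspace_ordered_chains] p r edge_chain vw)
    show "boundary (ordinary X) (p + ?e + r) =
        vertex_lift X f (boundary (reeb_space X f) (generator e))"
      unfolding bd p r edge_chain[OF vw] e boundary_reeb_edge[OF vw]
        chain_linear_simps[OF chain_linear_vertex_lift] vertex_lift_generator
      by simp
    have "reeb_chain_map X f (p + ?e + r) - generator e = reeb_chain_map X f p + reeb_chain_map X f r"
      unfolding q e induced_chain_map_single by simp
    also have "\<dots> \<in> orientation_relations (reeb_space X f) 1"
      by (intro chains.subspace_add[OF subspace_orientation_relations] p r)
    finally show "reeb_chain_map X f (p + ?e + r) - generator e \<in>
        orientation_relations (reeb_space X f) 1" .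
  qed
qed

lemma edge_lift_generator:
  assumes "e \<in> ordered_simplices (reeb_space X f) 1"
  shows "edge_lift X f (generator e :: _ \<Rightarrow>\<^sub>0 'k::field) \<in> ordered_chains (ordinary X) 1"
    and "boundary (ordinary X) (edge_lift X f (generator e :: _ \<Rightarrow>\<^sub>0 'k)) =
      vertex_lift X f (boundary (reeb_space X f) (generator e))"
    and "reeb_chain_map X f (edge_lift X f (generator e :: _ \<Rightarrow>\<^sub>0 'k)) - generator e \<in>
      orientation_relations (reeb_space X f) 1"
proof -
  have "edge_lift X f (generator e :: _ \<Rightarrow>\<^sub>0 'k) = (SOME p.
     p \<in> ordered_chains (ordinary X) 1 \<and>
     boundary (ordinary X) p = vertex_lift X f (boundary (reeb_space X f) (generator e)) \<and>
     reeb_chain_map X f p - generator e \<in> orientation_relations (reeb_space X f) 1)"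
    unfolding edge_lift_def chain_extend_single by (rule chains.scale_one)
  with someI_ex[OF edge_lift_exists[OF assms, where 'k = 'k]]
  show "edge_lift X f (generator e :: _ \<Rightarrow>\<^sub>0 'k) \<in> ordered_chains (ordinary X) 1"
    and "boundary (ordinary X) (edge_lift X f (generator e :: _ \<Rightarrow>\<^sub>0 'k)) =
      vertex_lift X f (boundary (reeb_space X f) (generator e))"
    and "reeb_chain_map X f (edge_lift X f (generator e :: _ \<Rightarrow>\<^sub>0 'k)) - generator e \<in>
      orientation_relations (reeb_space X f) 1"
    by metis+
qed

lemma edge_lift_ordered_chains:
  assumes "c \<in> ordered_chains (reeb_space X f) 1"
  shows "edge_lift X f c \<in> ordered_chains (ordinary X) 1"
  using assms
  by (intro chain_linear_in_subspace[OF chain_linear_edge_lift subspace_ordered_chains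
        edge_lift_generator(1)]) (simp_all add: ordered_chains_def)

lemma boundary_edge_lift:
  assumes "c \<in> ordered_chains (reeb_space X f) 1"
  shows "boundary (ordinary X) (edge_lift X f c) = vertex_lift X f (boundary (reeb_space X f) c)"
  using assms
  by (intro chain_linear_eq[OF chain_linear_comp[OF chain_linear_boundary chain_linear_edge_lift]
        chain_linear_comp[OF chain_linear_vertex_lift chain_linear_boundary]
        edge_lift_generator(2)]) (simp_all add: ordered_chains_def)

lemma reeb_chain_map_edge_lift:
  assumes "c \<in> ordered_chains (reeb_space X f) 1"
  shows "reeb_chain_map X f (edge_lift X f c) - c \<in> orientation_relations (reeb_space X f) 1"
  using assms
  by (intro chain_linear_in_subspace[OF
        chain_linear_diff[OF chain_linear_comp[OF chain_linear_induced chain_linear_edge_lift]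
          chain_linear_id]
        subspace_orientation_relations edge_lift_generator(3)]) (simp_all add: ordered_chains_def)

lemma edge_lift_cycles:
  assumes "z \<in> cycles (reeb_space X f) 1"
  shows "edge_lift X f z \<in> cycles (ordinary X) 1"
proof -
  have z: "z \<in> ordered_chains (reeb_space X f) 1" "boundary (reeb_space X f) z = 0"
    using assms by (simp_all add: cycles_def orientation_relations_0)
  show ?thesis
    using edge_lift_ordered_chains[OF z(1)] boundary_edge_lift[OF z(1)]
    by (simp add: z(2) cycles_def orientation_relations_0 chain_linear_simps[OF chain_linear_vertex_lift])
qed

lemma vertex_lift_ordered_chains:
  fixes c :: "_ \<Rightarrow>\<^sub>0 'k::field"
  assumes "c \<in> ordered_chains (reeb_space X f) 0"
  shows "vertex_lift X f c \<in> ordered_chains (ordinary X) 0"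
proof (rule chain_linear_in_subspace[OF chain_linear_vertex_lift subspace_ordered_chains])
  show "Poly_Mapping.keys c \<subseteq> ordered_simplices (reeb_space X f) 0"
    using assms by (simp add: ordered_chains_def)
  fix x assume "x \<in> ordered_simplices (reeb_space X f) 0"
  then obtain v where v: "{v} \<in> X" "x = (reeb_vertex X f v, [reeb_vertex X f v])"
    by (rule reeb_vertex_cases)
  show "vertex_lift X f (generator x :: _ \<Rightarrow>\<^sub>0 'k) \<in> ordered_chains (ordinary X) 0"
    using reeb_basepoint(1)[OF v(1)]
    by (simp add: v(2) vertex_lift_generator point_chain_def ordered_simplices_vertex)
      (simp add: ordinary_def)
qed

lemma reeb_chain_map_vertex_lift:
  fixes c :: "_ \<Rightarrow>\<^sub>0 'k::field"
  assumes "c \<in> ordered_chains (reeb_space X f) 0"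
  shows "reeb_chain_map X f (vertex_lift X f c) = c"
proof (rule chain_linear_eq[OF chain_linear_comp[OF chain_linear_induced chain_linear_vertex_lift]
      chain_linear_id])
  show "Poly_Mapping.keys c \<subseteq> ordered_simplices (reeb_space X f) 0"
    using assms by (simp add: ordered_chains_def)
  fix x assume "x \<in> ordered_simplices (reeb_space X f) 0"
  then obtain v where v: "{v} \<in> X" "x = (reeb_vertex X f v, [reeb_vertex X f v])"
    by (rule reeb_vertex_cases)
  show "reeb_chain_map X f (vertex_lift X f (generator x :: _ \<Rightarrow>\<^sub>0 'k)) = generator x"
    using reeb_basepoint(2)[OF v(1)]
    by (simp add: v(2) vertex_lift_generator point_chain_def induced_chain_map_single
        reeb_vertex_def[symmetric])
qed

lemma vertex_lift_reeb_chain_map: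
  fixes c :: "_ \<Rightarrow>\<^sub>0 'k::field"
  assumes "c \<in> ordered_chains (ordinary X) 0"
  shows "vertex_lift X f (reeb_chain_map X f c) - c \<in> boundaries (ordinary X) 0"
proof (rule chain_linear_in_subspace[OF chain_linear_diff[OF
        chain_linear_comp[OF chain_linear_vertex_lift chain_linear_induced] chain_linear_id]
      subspace_boundaries])
  show "Poly_Mapping.keys c \<subseteq> ordered_simplices (ordinary X) 0"
    using assms by (simp add: ordered_chains_def)
  fix x assume "x \<in> ordered_simplices (ordinary X) 0"
  then obtain v where v: "{v} \<in> X" "x = ({v}, [v])"
    by (auto simp: ordered_simplices_def ordinary_def length_Suc_conv)
  obtain p :: "_ \<Rightarrow>\<^sub>0 'k" where "p \<in> ordered_chains (ordinary X) 1"
      "boundary (ordinary X) p = point_chain (reeb_basepoint X f (reeb_vertex X f v)) - point_chain v"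
    using fibre_path_vertices[OF v(1) reeb_basepoint(1)[OF v(1)] reeb_basepoint(2)[OF v(1), symmetric]]
    by metis
  then show "vertex_lift X f (reeb_chain_map X f (generator x :: _ \<Rightarrow>\<^sub>0 'k)) - generator x \<in>
      boundaries (ordinary X) 0"
    using boundary_in_boundaries[of p "ordinary X" 0]
    by (simp add: v(2) vertex_lift_generator point_chain_def induced_chain_map_single)
qed

lemma vertex_lift_boundaries:
  assumes "b \<in> boundaries (reeb_space X f) 0"
  shows "vertex_lift X f b \<in> boundaries (ordinary X) 0"
proof -
  obtain c where c: "c \<in> ordered_chains (reeb_space X f) 1" "b = boundary (reeb_space X f) c"
    using assms by (auto simp: boundaries_def orientation_relations_0)
  have "vertex_lift X f b = boundary (ordinary X) (edge_lift X f c)"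
    using c by (simp add: boundary_edge_lift)
  then show ?thesis
    using boundary_in_boundaries[of "edge_lift X f c" "ordinary X" 0] edge_lift_ordered_chains[OF c(1)]
    by simp
qed


section \<open>Homology of the Reeb space\<close>

lemma reeb_homology_map_eq_class_map:
  "reeb_homology_map K X f n = class_map (reeb_space X f) n (reeb_chain_map X f)"
  by (intro ext) (simp add: reeb_homology_map_def homology_map_def class_map_def)

lemma reeb_homology_map_class:
  "reeb_homology_map K X f n (homology_class (ordinary X) n z) =
     homology_class (reeb_space X f) n (reeb_chain_map X f z)"
  unfolding reeb_homology_map_eq_class_map
  by (rule class_map_homology_class[OF chain_linear_induced
        induced_boundaries[OF generalized_map_reeb_class[OF X]]])

lemma linear_map_reeb_homology_map:
  "linear_map class_ring (homology K (ordinary X) n) (homology K (reeb_space X f) n)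
     (reeb_homology_map K X f n)"
  unfolding reeb_homology_map_eq_class_map
  by (intro linear_map_class_map chain_linear_induced induced_boundaries induced_cycles
      generalized_map_reeb_class[OF X])

text \<open>
  The inverse is induced by \<open>vertex_lift\<close>.  In degree 0 every chain is a cycle.
\<close>

lemma bij_betw_reeb_homology_map_0:
  fixes K :: "'k::field itself"
  shows "bij_betw (reeb_homology_map K X f 0)
    (carrier (homology K (ordinary X) 0)) (carrier (homology K (reeb_space X f) 0))"
proof -
  let ?R = "reeb_space X f" and ?q = "reeb_chain_map X f :: _ \<Rightarrow> _ \<Rightarrow>\<^sub>0 'k"
  have carr: "carrier (homology K P 0) = homology_class P 0 ` ordered_chains P 0" for P :: "('s, 'v) scomplex"
    by (simp add: homology_def cycles_0)
  have "inj_on (reeb_homology_map K X f 0)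
      (homology_class (ordinary X) 0 ` ordered_chains (ordinary X) 0)"
  proof (rule inj_onI)
    fix a b
    assume "a \<in> homology_class (ordinary X) 0 ` ordered_chains (ordinary X) 0"
      "b \<in> homology_class (ordinary X) 0 ` ordered_chains (ordinary X) 0"
      and eq: "reeb_homology_map K X f 0 a = reeb_homology_map K X f 0 b"
    then obtain y z where yz: "y \<in> ordered_chains (ordinary X) 0" "z \<in> ordered_chains (ordinary X) 0"
        "a = homology_class (ordinary X) 0 y" "b = homology_class (ordinary X) 0 z"
      by blast
    have "?q (y - z) \<in> boundaries ?R 0"
      using eq unfolding yz reeb_homology_map_class homology_class_eq_iff
      by (simp add: chain_linear_simps[OF chain_linear_induced])
    then have "vertex_lift X f (?q (y - z)) \<in> boundaries (ordinary X) 0"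
      by (rule vertex_lift_boundaries)
    moreover have "vertex_lift X f (?q (y - z)) - (y - z) \<in> boundaries (ordinary X) 0"
      by (intro vertex_lift_reeb_chain_map chains.subspace_diff[OF subspace_ordered_chains] yz)
    ultimately have "vertex_lift X f (?q (y - z)) - (vertex_lift X f (?q (y - z)) - (y - z)) \<in>
        boundaries (ordinary X) 0"
      by (rule chains.subspace_diff[OF subspace_boundaries])
    then show "a = b" unfolding yz homology_class_eq_iff by simp
  qed
  moreover have "reeb_homology_map K X f 0 ` homology_class (ordinary X) 0 `
      ordered_chains (ordinary X) 0 = homology_class ?R 0 ` ordered_chains ?R 0"
  proof (intro subset_antisym subsetI)
    fix a assume "a \<in> reeb_homology_map K X f 0 ` homology_class (ordinary X) 0 `
        ordered_chains (ordinary X) 0"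
    then show "a \<in> homology_class ?R 0 ` ordered_chains ?R 0"
      by (auto simp: reeb_homology_map_class
          intro!: imageI induced_ordered_chains[OF generalized_map_reeb_class[OF X]])
  next
    fix a assume "a \<in> homology_class ?R 0 ` (ordered_chains ?R 0 :: (_ \<Rightarrow>\<^sub>0 'k) set)"
    then obtain z where z: "z \<in> ordered_chains ?R 0" "a = homology_class ?R 0 z" by blast
    have "a = reeb_homology_map K X f 0 (homology_class (ordinary X) 0 (vertex_lift X f z))"
      using z by (simp add: reeb_homology_map_class reeb_chain_map_vertex_lift)
    then show "a \<in> reeb_homology_map K X f 0 ` homology_class (ordinary X) 0 `
        ordered_chains (ordinary X) 0"
      using vertex_lift_ordered_chains[OF z(1)] by blast
  qed
  ultimately show ?thesis
    unfolding bij_betw_def carr by (rule conjI)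
qed

text \<open>
  The section is induced by \<open>edge_lift\<close> after the projection \<open>\<pi>\<close> along the boundaries of the Reeb space:
  without \<open>\<pi>\<close>, boundaries need not be taken to boundaries.  As \<open>\<pi> z\<close> differs from \<open>z\<close> by a
  boundary, it is again a cycle, in the same homology class.
\<close>

lemma reeb_homology_map_1_section:
  fixes K :: "'k::field itself"
  obtains \<iota> where
    "linear_map class_ring (homology K (reeb_space X f) 1) (homology K (ordinary X) 1) \<iota>"
    "\<And>x. x \<in> carrier (homology K (reeb_space X f) 1) \<Longrightarrow> reeb_homology_map K X f 1 (\<iota> x) = x"
proof -
  let ?R = "reeb_space X f"
  let ?B = "boundaries ?R 1 :: (_ \<Rightarrow>\<^sub>0 'k) set"
  obtain \<pi> where \<pi>: "chain_linear \<pi>" "\<And>b. b \<in> ?B \<Longrightarrow> \<pi> b = 0" "\<And>c. \<pi> c - c \<in> ?B"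
    using projection_along_subspace[OF subspace_boundaries] by blast
  let ?t = "\<lambda>c. edge_lift X f (\<pi> c)"
  have lin: "chain_linear ?t" by (rule chain_linear_comp[OF chain_linear_edge_lift \<pi>(1)])
  have B: "?t ` ?B \<subseteq> boundaries (ordinary X) 1"
    using \<pi>(2) chains.subspace_0[OF subspace_boundaries]
    by (auto simp: chain_linear_simps[OF chain_linear_edge_lift])
  have B_cycles: "?B \<subseteq> cycles ?R 1"
    by (rule boundaries_1_subset_cycles[OF generalized_complex_reeb_space[OF X]])
  have \<pi>_cycles: "\<pi> z \<in> cycles ?R 1" if "z \<in> cycles ?R 1" for z
  proof -
    have "(\<pi> z - z) + z \<in> cycles ?R 1"
      using B_cycles \<pi>(3) that by (intro chains.subspace_add[OF subspace_cycles]) blast+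
    then show ?thesis by simp
  qed
  show ?thesis
  proof
    show "linear_map class_ring (homology K ?R 1) (homology K (ordinary X) 1)
        (class_map (ordinary X) 1 ?t)"
      by (rule linear_map_class_map[OF lin B]) (use \<pi>_cycles edge_lift_cycles in blast)
    fix x assume "x \<in> carrier (homology K ?R 1)"
    then obtain z where z: "z \<in> cycles ?R 1" "x = homology_class ?R 1 z"
      by (auto simp: homology_def)
    have "reeb_chain_map X f (?t z) - \<pi> z \<in> ?B"
      using reeb_chain_map_edge_lift[of "\<pi> z"] \<pi>_cycles[OF z(1)]
        orientation_relations_subset_boundaries by (auto simp: cycles_def)
    from chains.subspace_add[OF subspace_boundaries this \<pi>(3)[of z]]
    have "reeb_chain_map X f (?t z) - z \<in> ?B" by simp
    then show "reeb_homology_map K X f 1 (class_map (ordinary X) 1 ?t x) = x"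
      unfolding z(2) class_map_homology_class[OF lin B] reeb_homology_map_class homology_class_eq_iff .
  qed
qed

end

theorem corollary4p2:
  fixes K :: "'k::field itself"
    and X :: "'a set set" and Y :: "'b set set" and f :: "'a \<Rightarrow> 'b"
  assumes "simplicial_complex X" and "simplicial_complex Y" and "simplicial_map f X Y"
  shows "linear_map class_ring (homology K (ordinary X) 0) (homology K (reeb_space X f) 0)
           (reeb_homology_map K X f 0) \<and>
         bij_betw (reeb_homology_map K X f 0)
           (carrier (homology K (ordinary X) 0)) (carrier (homology K (reeb_space X f) 0)) \<and>
         (\<exists>\<iota>. linear_map class_ring
                (homology K (reeb_space X f) 1) (homology K (ordinary X) 1) \<iota> \<and>
              inj_on \<iota> (carrier (homology K (reeb_space X f) 1)) \<and>
              (\<forall>x \<in> carrier (homology K (reeb_space X f) 1). reeb_homology_map K X f 1 (\<iota> x) = x))"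
proof (intro conjI linear_map_reeb_homology_map[OF assms(1)] bij_betw_reeb_homology_map_0[OF assms(1)])
  obtain \<iota> where \<iota>:
    "linear_map class_ring (homology K (reeb_space X f) 1) (homology K (ordinary X) 1) \<iota>"
    "\<And>x. x \<in> carrier (homology K (reeb_space X f) 1) \<Longrightarrow> reeb_homology_map K X f 1 (\<iota> x) = x"
    using reeb_homology_map_1_section[OF assms(1)] by blast
  have "inj_on \<iota> (carrier (homology K (reeb_space X f) 1))"
    by (rule inj_on_inverseI[of _ "reeb_homology_map K X f 1"]) (rule \<iota>(2))
  with \<iota> show "\<exists>\<iota>. linear_map class_ring
      (homology K (reeb_space X f) 1) (homology K (ordinary X) 1) \<iota> \<and>
      inj_on \<iota> (carrier (homology K (reeb_space X f) 1)) \<and>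
      (\<forall>x \<in> carrier (homology K (reeb_space X f) 1). reeb_homology_map K X f 1 (\<iota> x) = x)"
    by blast
qed

end
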